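(* Let $n$ be a positive integer and $u\neq0$ a (real or complex) parameter, and let $\alpha_1,\alpha_2$ be points at infinity with $\mathrm{Re}(u\alpha_j)=(-1)^j\infty$ ($j=1,2$). Let $\mathcal{L}(\xi)$ be a path in $\Xi_1(u,\alpha_1)\cap\Xi_2(u,\alpha_2)$ linking $\alpha_1$ to $\alpha_2$ that contains the point $\xi$, having the properties (i) $\mathcal{L}(\xi)$ consists of a finite chain of $R_2$ arcs, and (ii) as $t$ passes along $\mathcal{L}(\xi)$ from $\alpha_1$ to $\alpha_2$, the real part of $ut$ is monotonic. Further assume $|u|$ is sufficiently large so that $\int_{\mathcal{L}(\xi)}|\psi(t)\,dt|<2|u|$. Then there exists a unique particular solution of $$\frac{d^2W}{d\xi^2}-\{u^2+\psi(\xi)\}W=\varpi(\xi)$$ of the form $$G(u,\xi)=\frac{1}{u^2}\sum_{s=0}^{n-1}\frac{G_s(\xi)}{u^{2s}}+\varepsilon_n(u,\xi),$$ where $$\begin{aligned}|\varepsilon_n(u,\xi)|\le{}&\frac{1}{|u|^{2n+2}}\left\{|G_n(\xi)|+\frac12\int_{\mathcal{L}(\xi)}|G_n'(t)\,dt|\right\}\\&+\frac{L_n(\xi)}{2|u|^{2n+3}}\left\{1-\frac{1}{2|u|}\int_{\mathcal{L}(\xi)}|\psi(t)\,dt|\right\}^{-1}\int_{\mathcal{L}(\xi)}|\psi(t)\,dt|,\end{aligned}$$ in which $$L_n(\xi)=\sup_{w\in\mathcal{L}(\xi)}|G_n(w)|+\frac12\int_{\mathcal{L}(\xi)}|G_n'(t)\,dt|.$$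 In the bounds the integrals and supremum are assumed to exist. More generally, for any positive integer $r$, $$\begin{aligned}|\varepsilon_n(u,\xi)|\le{}&\left|\sum_{s=n}^{n+r-1}\frac{G_s(\xi)}{u^{2s+2}}\right|+\frac{1}{|u|^{2n+2r+2}}\left\{|G_{n+r}(\xi)|+\frac12\int_{\mathcal{L}(\xi)}|G_{n+r}'(t)\,dt|\right\}\\&+\frac{L_{n+r}(\xi)}{2|u|^{2n+2r+3}}\left\{1-\frac{1}{2|u|}\int_{\mathcal{L}(\xi)}|\psi(t)\,dt|\right\}^{-1}\int_{\mathcal{L}(\xi)}|\psi(t)\,dt|.\end{aligned}$$
   Context: $\Delta$ is an unbounded complex domain in the $\xi$-plane, and $\psi,\varpi$ are functions analytic in $\Delta$, independent of $u$. (They arise from $d^2w/dz^2-\{u^2f(z)+g(z)\}w=p(z)$, with $f$ nonvanishing and $p$ analytic, via $\xi=\int f^{1/2}(z)\,dz$, $W=f^{1/4}(z)w$, which gives $\psi=\dfrac{4ff''-5f'^2}{16f^3}+\dfrac gf$ and $\varpi(\xi)=f^{-3/4}(z)p(z)$.) Coefficients: $G_0(\xi)=-\varpi(\xi)$ and $G_{s+1}(\xi)=G_s''(\xi)-\psi(\xi)G_s(\xi)$ ($s=0,1,2,\dots$). For $j=1,2$, $\Xi_j(u,\alpha_j)$ is the set of points $\xi$ for which there is a path $\mathcal{L}_j$ linking $\xi$ with $\alpha_j$ in $\Delta$ such that $\mathcal{L}_j$ consists of a finite chain of $R_2$ arcs, and as $t$ passes along $\mathcal{L}_j$ from $\alpha_j$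 to $\xi$ the real part of $(-1)^jut$ is nonincreasing. An $R_2$ arc is an arc with a parametrization $t=t(\tau)$ for which $t''(\tau)$ is continuous and $t'(\tau)$ does not vanish. $\int|h(t)\,dt|$ denotes integration with respect to arc length. The point $\alpha_j$ is the infinite end of a fixed unbounded $R_2$ arc in $\Delta$, with which the paths coincide near $\alpha_j$; $\mathrm{Re}(u\alpha_j)=(-1)^j\infty$ means $\mathrm{Re}(ut)\to(-1)^j\infty$ as $t\to\alpha_j$ along it. The particular solution $G(u,\xi)$ is a single function, not depending on $\xi$-specific choices: the bound holds at every point $\xi$ for which such a path $\mathcal{L}(\xi)$ exists (in particular at all points of a given such path, which may serve as $\mathcal L$ for each of its points).
   Formalization: The solution is asserted on each simply connected open subdomain of Δ containing the path (one is proved to exist; Δ itself if simply connected), with bounds for paths inside it; on multiply connected Δ a single-valued solution can fail to exist (ψ=0, ϖ=1/ξ on the punctured plane). *)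

theory Defs
  imports "HOL-Complex_Analysis.Complex_Analysis"
begin

text \<open>Regular $C^2$ parametrizations. Derivatives are taken within \<open>I\<close>, hence one-sided at an end point
  of \<open>I\<close>. Arcs are parametrized, and self-intersections are not excluded.\<close>

definition R2_arc :: "(real \<Rightarrow> complex) \<Rightarrow> real set \<Rightarrow> bool" where
  "R2_arc t I \<longleftrightarrow> (\<exists>t' t''.
     (\<forall>\<tau>\<in>I. (t has_vector_derivative t' \<tau>) (at \<tau> within I) \<and>
            (t' has_vector_derivative t'' \<tau>) (at \<tau> within I) \<and> t' \<tau> \<noteq> 0) \<and>
     continuous_on I t'')"

text \<open>\<open>B\<close> is the set of junctions: every closed subinterval with no junction in its interior carries
  a single arc.\<close>

definition R2_chain :: "(real \<Rightarrow> complex) \<Rightarrow> real set \<Rightarrow> bool" where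
  "R2_chain t I \<longleftrightarrow> continuous_on I t \<and>
     (\<exists>B. finite B \<and>
        (\<forall>J. J \<subseteq> I \<and> is_interval J \<and> closed J \<and> interior J \<inter> B = {} \<longrightarrow> R2_arc t J))"

text \<open>The point at infinity $\alpha_j$ is represented by an unbounded arc \<open>a\<close>, parametrized by
  $[0,\infty)$ towards its infinite end; the last conjunct is
  $\mathrm{Re}(u\alpha_j) = (-1)^j\infty$.\<close>

definition infinite_end :: "complex set \<Rightarrow> complex \<Rightarrow> nat \<Rightarrow> (real \<Rightarrow> complex) \<Rightarrow> bool" where
  "infinite_end \<Delta> u j a \<longleftrightarrow> R2_arc a {0..} \<and> a ` {0..} \<subseteq> \<Delta> \<and>
     filterlim (\<lambda>\<tau>. (-1) ^ j * Re (u * a \<tau>)) at_top at_top"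

text \<open>The path \<open>t\<close> coincides, up to an increasing change of parameter, with \<open>a\<close> near the infinite end.\<close>

definition same_end :: "(real \<Rightarrow> complex) \<Rightarrow> (real \<Rightarrow> complex) \<Rightarrow> bool" where
  "same_end t a \<longleftrightarrow> (\<exists>T S \<phi>. T \<ge> 0 \<and> S \<ge> 0 \<and> strict_mono_on {T..} \<phi> \<and> \<phi> ` {T..} = {S..} \<and>
     (\<forall>\<tau>\<ge>T. t \<tau> = a (\<phi> \<tau>)))"

text \<open>The paths are parametrized from $\xi$ out to $\alpha_j$, so that ``nonincreasing from $\alpha_j$ to
  $\xi$'' becomes \<open>mono_on\<close>.\<close>

definition Xi :: "complex set \<Rightarrow> complex \<Rightarrow> (nat \<Rightarrow> real \<Rightarrow> complex) \<Rightarrow> nat \<Rightarrow> complex set" where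
  "Xi \<Delta> u \<alpha> j = {\<xi>. \<exists>t. R2_chain t {0..} \<and> t ` {0..} \<subseteq> \<Delta> \<and> t 0 = \<xi> \<and> same_end t (\<alpha> j) \<and>
     mono_on {0..} (\<lambda>\<tau>. Re ((-1) ^ j * u * t \<tau>))}"

text \<open>Paths $\mathcal{L}$ from $\alpha_1$ to $\alpha_2$, parametrized by the whole real line.\<close>

definition linking_path ::
    "complex set \<Rightarrow> complex \<Rightarrow> (nat \<Rightarrow> real \<Rightarrow> complex) \<Rightarrow> (real \<Rightarrow> complex) \<Rightarrow> bool" where
  "linking_path \<Delta> u \<alpha> \<gamma> \<longleftrightarrow> R2_chain \<gamma> UNIV \<and>
     range \<gamma> \<subseteq> Xi \<Delta> u \<alpha> 1 \<inter> Xi \<Delta> u \<alpha> 2 \<and>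
     same_end (\<lambda>\<tau>. \<gamma> (- \<tau>)) (\<alpha> 1) \<and> same_end \<gamma> (\<alpha> 2) \<and>
     (mono (\<lambda>\<tau>. Re (u * \<gamma> \<tau>)) \<or> antimono (\<lambda>\<tau>. Re (u * \<gamma> \<tau>)))"

text \<open>$\int_{\mathcal{L}} |h(t)\,dt|$. The derivative of \<open>\<gamma>\<close> is undefined at most at the finitely
  many junctions.\<close>

definition arc_density :: "(complex \<Rightarrow> complex) \<Rightarrow> (real \<Rightarrow> complex) \<Rightarrow> real \<Rightarrow> real" where
  "arc_density h \<gamma> \<tau> = norm (h (\<gamma> \<tau>)) * norm (vector_derivative \<gamma> (at \<tau>))"

definition arc_integrable :: "(complex \<Rightarrow> complex) \<Rightarrow> (real \<Rightarrow> complex) \<Rightarrow> bool" where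
  "arc_integrable h \<gamma> \<longleftrightarrow> integrable lborel (arc_density h \<gamma>)"

definition arc_integral :: "(complex \<Rightarrow> complex) \<Rightarrow> (real \<Rightarrow> complex) \<Rightarrow> real" where
  "arc_integral h \<gamma> = (LINT \<tau>|lborel. arc_density h \<gamma> \<tau>)"

primrec Gcoeff ::
    "(complex \<Rightarrow> complex) \<Rightarrow> (complex \<Rightarrow> complex) \<Rightarrow> nat \<Rightarrow> complex \<Rightarrow> complex" where
  "Gcoeff \<psi> \<omega> 0 = (\<lambda>\<xi>. - \<omega> \<xi>)"
| "Gcoeff \<psi> \<omega> (Suc s) =
     (\<lambda>\<xi>. deriv (deriv (Gcoeff \<psi> \<omega> s)) \<xi> - \<psi> \<xi> * Gcoeff \<psi> \<omega> s \<xi>)"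

definition solution_on ::
    "complex set \<Rightarrow> complex \<Rightarrow> (complex \<Rightarrow> complex) \<Rightarrow> (complex \<Rightarrow> complex) \<Rightarrow>
     (complex \<Rightarrow> complex) \<Rightarrow> bool" where
  "solution_on D u \<psi> \<omega> W \<longleftrightarrow> W holomorphic_on D \<and>
     (\<forall>\<xi>\<in>D. deriv (deriv W) \<xi> - (u\<^sup>2 + \<psi> \<xi>) * W \<xi> = \<omega> \<xi>)"

text \<open>$\varepsilon_n(u,\xi)$, determined by \<open>W\<close>.\<close>

definition eps ::
    "complex \<Rightarrow> (complex \<Rightarrow> complex) \<Rightarrow> (complex \<Rightarrow> complex) \<Rightarrow> (complex \<Rightarrow> complex) \<Rightarrow>
     nat \<Rightarrow> complex \<Rightarrow> complex" where
  "eps u \<psi> \<omega> W n \<xi> = W \<xi> - 1 / u\<^sup>2 * (\<Sum>s<n. Gcoeff \<psi> \<omega> s \<xi> / u ^ (2 * s))"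

definition bound_terms_exist ::
    "(complex \<Rightarrow> complex) \<Rightarrow> (complex \<Rightarrow> complex) \<Rightarrow> nat \<Rightarrow> (real \<Rightarrow> complex) \<Rightarrow> bool" where
  "bound_terms_exist \<psi> \<omega> m \<gamma> \<longleftrightarrow> arc_integrable (deriv (Gcoeff \<psi> \<omega> m)) \<gamma> \<and>
     bdd_above ((\<lambda>w. norm (Gcoeff \<psi> \<omega> m w)) ` range \<gamma>)"

definition Lconst ::
    "(complex \<Rightarrow> complex) \<Rightarrow> (complex \<Rightarrow> complex) \<Rightarrow> nat \<Rightarrow> (real \<Rightarrow> complex) \<Rightarrow> real" where
  "Lconst \<psi> \<omega> m \<gamma> = (SUP w\<in>range \<gamma>. norm (Gcoeff \<psi> \<omega> m w)) +
     1 / 2 * arc_integral (deriv (Gcoeff \<psi> \<omega> m)) \<gamma>"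

definition error_bound ::
    "complex \<Rightarrow> (complex \<Rightarrow> complex) \<Rightarrow> (complex \<Rightarrow> complex) \<Rightarrow> nat \<Rightarrow> (real \<Rightarrow> complex) \<Rightarrow>
     complex \<Rightarrow> real" where
  "error_bound u \<psi> \<omega> m \<gamma> \<xi> =
     1 / norm u ^ (2 * m + 2) *
       (norm (Gcoeff \<psi> \<omega> m \<xi>) + 1 / 2 * arc_integral (deriv (Gcoeff \<psi> \<omega> m)) \<gamma>) +
     Lconst \<psi> \<omega> m \<gamma> / (2 * norm u ^ (2 * m + 3)) *
       inverse (1 - 1 / (2 * norm u) * arc_integral \<psi> \<gamma>) * arc_integral \<psi> \<gamma>"

text \<open>All standing hypotheses on a path $\mathcal{L}$, for the expansion truncated at \<open>n\<close>.\<close>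

definition admissible_path ::
    "complex set \<Rightarrow> complex \<Rightarrow> (nat \<Rightarrow> real \<Rightarrow> complex) \<Rightarrow> (complex \<Rightarrow> complex) \<Rightarrow>
     (complex \<Rightarrow> complex) \<Rightarrow> nat \<Rightarrow> (real \<Rightarrow> complex) \<Rightarrow> bool" where
  "admissible_path \<Delta> u \<alpha> \<psi> \<omega> n \<gamma> \<longleftrightarrow> linking_path \<Delta> u \<alpha> \<gamma> \<and>
     arc_integrable \<psi> \<gamma> \<and> arc_integral \<psi> \<gamma> < 2 * norm u \<and> bound_terms_exist \<psi> \<omega> n \<gamma>"

text \<open>A domain on which the solution is single-valued. If \<open>\<Delta>\<close> is simply connected, \<open>D = \<Delta>\<close> is allowed.
  Otherwise no solution need exist on all of \<open>\<Delta>\<close>: $W'' - u^2 W = 1/\xi$ has none on the punctured plane,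
  although every point of it lies on a path as above. Note that \<open>simply_connected\<close> implies \<open>connected\<close>.\<close>

definition branch_domain :: "complex set \<Rightarrow> complex set \<Rightarrow> bool" where
  "branch_domain \<Delta> D \<longleftrightarrow> open D \<and> simply_connected D \<and> D \<subseteq> \<Delta>"

end

theory Submission
  imports Defs
begin

text \<open>The error satisfies $\varepsilon_n'' = (u^2 + \psi)\varepsilon_n - G_n / u^{2n}$. Inverting $d^2/d\xi^2 - u^2$
  along the path by variation of parameters from both infinite ends gives a kernel bounded by 1, so
  the resulting operator $f \mapsto K(\psi f)$ contracts by the factor $\int|\psi\,dt| / (2|u|) < 1$ in the
  supremum norm on the path. Its Neumann series consists of holomorphic functions; as each term solves
  a linear equation driven by the previous one, summability of values and first derivatives at one
  point spreads to the whole domain, and the sum is the solution with the stated bound. Conversely a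
  homogeneous solution bounded on the path equals its own image under the contraction, up to
  $A e^{u\xi} + B e^{-u\xi}$ with $A = B = 0$ by boundedness, hence vanishes. Since all paths share their
  tails near $\alpha_1$ and $\alpha_2$, this makes the solution independent of the path.\<close>

section \<open>Integration along the path\<close>

text \<open>The kernel estimates hold on the path only, a curve, while a holomorphic sum needs
  uniform convergence on discs. Hence every iterate carries a bound on its first derivative too:
  value and derivative are the initial data that a second-order equation propagates.

  The factor 1/2 in the bounds comes from the prefactor 1/(2u) of variation of parameters; the two
  kernels act on complementary parts of the path and together cost one arc integral. Integrating the
  G_n term by parts gives G_n(\<xi>) plus half an integral of G_n'. The supremum in L_n enters
  because the iterates after the zeroth are estimated uniformly on the path.

  Two obstacles remain. Inverting the operator takes single-valued primitives, so a simply connected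
  domain around the path has to be built inside \<Delta>. And the bound with r compares expansions
  that differ by G_n, ..., G_(n+r-1), of which only G_n is assumed bounded; an interpolation
  inequality along the path bounds the others.\<close>

definition path_derivative :: "(real \<Rightarrow> complex) \<Rightarrow> (real \<Rightarrow> complex) \<Rightarrow> bool" where
  "path_derivative \<gamma> \<gamma>' \<longleftrightarrow> continuous_on UNIV \<gamma> \<and>
     (\<exists>B. finite B \<and> (\<forall>\<tau>. \<tau> \<notin> B \<longrightarrow> (\<gamma> has_vector_derivative \<gamma>' \<tau>) (at \<tau>)))"

lemma path_derivative_reverse:
  assumes "path_derivative \<gamma> \<gamma>'"
  shows "path_derivative (\<lambda>\<tau>. \<gamma> (- \<tau>)) (\<lambda>\<tau>. - \<gamma>' (- \<tau>))"
proof -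
  obtain B where B: "finite B" "\<And>\<tau>. \<tau> \<notin> B \<Longrightarrow> (\<gamma> has_vector_derivative \<gamma>' \<tau>) (at \<tau>)"
    and c: "continuous_on UNIV \<gamma>"
    using assms unfolding path_derivative_def by blast
  have "((\<lambda>\<tau>. \<gamma> (- \<tau>)) has_vector_derivative - \<gamma>' (- \<tau>)) (at \<tau>)" if "\<tau> \<notin> uminus ` B" for \<tau>
  proof -
    have "- \<tau> \<notin> B" using that by (metis image_eqI minus_minus)
    then have "(\<gamma> has_vector_derivative \<gamma>' (- \<tau>)) (at (- \<tau>))" using B by blast
    moreover have "(uminus has_real_derivative - 1) (at \<tau>)"
      by (auto intro!: derivative_eq_intros)
    ultimately show ?thesis
      using vector_diff_chain_at[of uminus "- 1" \<tau> \<gamma> "\<gamma>' (- \<tau>)"]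
      by (simp add: o_def has_real_derivative_iff_has_vector_derivative)
  qed
  moreover have "continuous_on UNIV (\<lambda>\<tau>. \<gamma> (- \<tau>))"
    by (rule continuous_on_compose2[OF c]) (auto intro: continuous_intros)
  ultimately show ?thesis
    unfolding path_derivative_def using B(1) by blast
qed

lemma R2_chain_path_derivative:
  assumes "R2_chain \<gamma> UNIV"
  shows "path_derivative \<gamma> (\<lambda>\<tau>. vector_derivative \<gamma> (at \<tau>))"
proof -
  obtain B where B: "finite B"
    "\<And>J. is_interval J \<Longrightarrow> closed J \<Longrightarrow> interior J \<inter> B = {} \<Longrightarrow> R2_arc \<gamma> J"
    and c: "continuous_on UNIV \<gamma>"
    using assms unfolding R2_chain_def by auto
  have "(\<gamma> has_vector_derivative vector_derivative \<gamma> (at \<tau>)) (at \<tau>)" if \<tau>: "\<tau> \<notin> B" for \<tau>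
  proof -
    have "open (- B)" using B(1) by (simp add: finite_imp_closed open_Compl)
    then obtain e where e: "e > 0" "ball \<tau> e \<subseteq> - B"
      using \<tau> by (metis ComplI openE)
    have "R2_arc \<gamma> (cball \<tau> (e / 2))"
      using e subset_ball[of "e / 2" e \<tau>] by (intro B(2)) (auto simp: is_interval_cball_1)
    moreover have "\<tau> \<in> cball \<tau> (e / 2)" using e by simp
    ultimately obtain d where "(\<gamma> has_vector_derivative d) (at \<tau> within cball \<tau> (e / 2))"
      unfolding R2_arc_def by blast
    moreover have "at \<tau> within cball \<tau> (e / 2) = at \<tau>"
      using e by (intro at_within_interior) (simp add: interior_cball)
    ultimately have "(\<gamma> has_vector_derivative d) (at \<tau>)"
      by (simp only:)
    then show ?thesis
      by (simp only: vector_derivative_at)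
  qed
  with B(1) c show ?thesis
    unfolding path_derivative_def by blast
qed

text \<open>The fundamental theorem tolerates the finitely many junctions and yields a gauge
  integral of the derivative; the comparison with the majorant \<open>\<rho>\<close> is made there,
  and the integral of \<open>\<rho>\<close> is then read as a Lebesgue integral.\<close>

lemma increment_bound:
  fixes \<rho> :: "real \<Rightarrow> real"
  assumes \<gamma>: "path_derivative \<gamma> \<gamma>'" and D: "open D" "range \<gamma> \<subseteq> D" and F: "F holomorphic_on D"
    and "a \<le> b" and \<rho>: "integrable lborel \<rho>"
    and bound: "\<And>s. s \<in> {a..b} \<Longrightarrow> norm (deriv F (\<gamma> s)) * norm (\<gamma>' s) \<le> \<rho> s"
  shows "norm (F (\<gamma> b) - F (\<gamma> a)) \<le> (LINT s:{a..b}|lborel. \<rho> s)"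
proof -
  obtain B where B: "finite B" "\<And>\<tau>. \<tau> \<notin> B \<Longrightarrow> (\<gamma> has_vector_derivative \<gamma>' \<tau>) (at \<tau>)"
    and c: "continuous_on UNIV \<gamma>"
    using \<gamma> unfolding path_derivative_def by blast
  let ?f = "\<lambda>s. \<gamma>' s * deriv F (\<gamma> s)"
  have hi: "(?f has_integral F (\<gamma> b) - F (\<gamma> a)) {a..b}"
  proof (rule fundamental_theorem_of_calculus_interior_strong[OF B(1) \<open>a \<le> b\<close>])
    fix x assume "x \<in> {a<..<b} - B"
    moreover have "(F has_field_derivative deriv F (\<gamma> x)) (at (\<gamma> x))"
      using D F by (intro holomorphic_derivI[of _ D]) auto
    ultimately show "((\<lambda>s. F (\<gamma> s)) has_vector_derivative ?f x) (at x)"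
      using field_vector_diff_chain_at[of \<gamma> "\<gamma>' x" x F] B(2) by (simp add: o_def)
  next
    show "continuous_on {a..b} (\<lambda>s. F (\<gamma> s))"
      by (rule continuous_on_compose2[OF holomorphic_on_imp_continuous_on[OF F]])
         (use c D in \<open>auto intro: continuous_on_subset\<close>)
  qed
  have si: "set_integrable lborel {a..b} \<rho>"
    using \<rho> unfolding set_integrable_def by (intro integrable_mult_indicator) auto
  have "norm (integral {a..b} ?f) \<le> integral {a..b} \<rho>"
    using hi bound set_borel_integral_eq_integral(1)[OF si]
    by (intro Henstock_Kurzweil_Integration.integral_norm_bound_integral)
       (auto simp: norm_mult mult.commute has_integral_integrable)
  then show ?thesis
    using hi set_borel_integral_eq_integral(2)[OF si] by (simp add: integral_unique)
qed

lemma set_integral_vanishing: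
  fixes \<rho> :: "real \<Rightarrow> real"
  assumes \<rho>: "integrable lborel \<rho>" and A: "\<And>n::nat. A n \<in> sets lborel"
    and ev: "\<And>x. \<forall>\<^sub>F n in sequentially. x \<notin> A n"
  shows "(\<lambda>n. LINT s:A n|lborel. \<rho> s) \<longlonglongrightarrow> 0"
proof -
  have "(\<lambda>n. LINT s|lborel. indicat_real (A n) s *\<^sub>R \<rho> s) \<longlonglongrightarrow> (LINT s|(lborel::real measure). (0::real))"
  proof (rule integral_dominated_convergence[where w="\<lambda>s. norm (\<rho> s)"])
    show "AE x in lborel. (\<lambda>n. indicator (A n) x *\<^sub>R \<rho> x) \<longlonglongrightarrow> 0"
    proof (rule AE_I2)
      fix x
      have "\<forall>\<^sub>F n in sequentially. indicator (A n) x *\<^sub>R \<rho> x = 0"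
        using ev[of x] by eventually_elim auto
      then show "(\<lambda>n. indicator (A n) x *\<^sub>R \<rho> x) \<longlonglongrightarrow> 0"
        by (rule tendsto_eventually)
    qed
    show "AE x in lborel. norm (indicator (A n) x *\<^sub>R \<rho> x) \<le> norm (\<rho> x)" for n
      by (auto simp: indicator_def)
  qed (use \<rho> A in \<open>auto intro: integrable_norm borel_measurable_scaleR\<close>)
  then show ?thesis
    by (simp add: set_lebesgue_integral_def)
qed

lemma set_integral_mono_nonneg:
  fixes \<rho> :: "real \<Rightarrow> real"
  assumes "integrable lborel \<rho>" "\<And>s. 0 \<le> \<rho> s" "A \<subseteq> C" "A \<in> sets lborel" "C \<in> sets lborel"
  shows "(LINT s:A|lborel. \<rho> s) \<le> (LINT s:C|lborel. \<rho> s)"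
  unfolding set_lebesgue_integral_def using assms
  by (intro integral_mono integrable_mult_indicator) (auto simp: indicator_def)

lemma set_integral_le_integral:
  fixes \<rho> :: "real \<Rightarrow> real"
  assumes "integrable lborel \<rho>" "\<And>s. 0 \<le> \<rho> s" "A \<in> sets lborel"
  shows "(LINT s:A|lborel. \<rho> s) \<le> (LINT s|lborel. \<rho> s)"
  using set_integral_mono_nonneg[OF assms(1,2) _ assms(3), of UNIV]
  by (simp add: set_lebesgue_integral_def)

text \<open>Towards the left end the weight \<open>exp (m b)\<close> does not grow, since
  \<open>m\<close> is monotone, and the tails of \<open>\<rho>\<close> vanish; so \<open>f\<close>
  is Cauchy there. For a primitive, \<open>l\<close> is its value at the infinite end. The weight is
  kept in the conclusion because it later cancels against the exponential in front of the
  integral.\<close>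

lemma limit_at_left_end:
  fixes f :: "real \<Rightarrow> complex" and m \<rho> :: "real \<Rightarrow> real"
  assumes \<rho>: "integrable lborel \<rho>" "\<And>s. 0 \<le> \<rho> s" and m: "mono m"
    and f: "\<And>a b. a \<le> b \<Longrightarrow> norm (f b - f a) \<le> exp (m b) * (LINT s:{a..b}|lborel. \<rho> s)"
  obtains l where "\<And>\<tau>. norm (f \<tau> - l) \<le> exp (m \<tau>) * (LINT s:{..\<tau>}|lborel. \<rho> s)"
proof -
  define X where "X n = f (- real n)" for n
  define T where "T \<tau> = (LINT s:{..\<tau>}|lborel. \<rho> s)" for \<tau>
  have fT: "norm (f b - f a) \<le> exp (m b) * T b" if "a \<le> b" for a b
    using f[OF that] set_integral_mono_nonneg[OF \<rho>, of "{a..b}" "{..b}"]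
    unfolding T_def by (smt (verit) atLeastAtMost_iff atMost_iff exp_gt_zero mult_left_mono subsetI sets_lborel atLeastAtMost_borel atMost_borel)
  have T0: "(\<lambda>n. T (- real n)) \<longlonglongrightarrow> 0"
    unfolding T_def
  proof (rule set_integral_vanishing[OF \<rho>(1)])
    fix x :: real
    show "\<forall>\<^sub>F n in sequentially. x \<notin> {..- real n}"
      using eventually_gt_at_top[of "nat \<lceil>- x\<rceil>"] by eventually_elim (auto, linarith)
  qed auto
  have "Cauchy X"
  proof (rule metric_CauchyI)
    fix e :: real assume "e > 0"
    have "(\<lambda>n. exp (m 0) * T (- real n)) \<longlonglongrightarrow> exp (m 0) * 0"
      by (intro tendsto_intros T0)
    then have "\<forall>\<^sub>F n in sequentially. exp (m 0) * T (- real n) < e / 2"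
      using \<open>e > 0\<close> order_tendstoD(2)[of _ "0::real" sequentially "e / 2"] by simp
    then obtain N where N: "exp (m 0) * T (- real N) < e / 2"
      by (auto simp: eventually_sequentially)
    have "dist (X n) (X N) < e / 2" if "n \<ge> N" for n
    proof -
      have "norm (X N - X n) \<le> exp (m (- real N)) * T (- real N)"
        unfolding X_def using that by (intro fT) auto
      also have "\<dots> \<le> exp (m 0) * T (- real N)"
        using monoD[OF m, of "- real N" 0] \<rho>(2)
        by (intro mult_right_mono) (auto simp: T_def set_lebesgue_integral_def intro!: integral_nonneg)
      finally show ?thesis using N by (simp add: dist_norm norm_minus_commute)
    qed
    then show "\<exists>M. \<forall>k\<ge>M. \<forall>n\<ge>M. dist (X k) (X n) < e"
      by (metis dist_commute dist_triangle_half_l)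
  qed
  then obtain l where l: "X \<longlonglongrightarrow> l"
    by (auto simp: Cauchy_convergent_iff convergent_def)
  have "norm (f \<tau> - l) \<le> exp (m \<tau>) * T \<tau>" for \<tau>
  proof (rule tendsto_upperbound)
    show "(\<lambda>n. norm (f \<tau> - X n)) \<longlonglongrightarrow> norm (f \<tau> - l)"
      by (intro tendsto_intros l)
    show "\<forall>\<^sub>F n in sequentially. norm (f \<tau> - X n) \<le> exp (m \<tau>) * T \<tau>"
      using eventually_ge_at_top[of "nat \<lceil>- \<tau>\<rceil>"]
      by eventually_elim (unfold X_def, intro fT, linarith)
  qed auto
  then show thesis
    using that unfolding T_def by blast
qed

lemma limit_at_right_end:
  fixes f :: "real \<Rightarrow> complex" and m \<rho> :: "real \<Rightarrow> real"
  assumes \<rho>: "integrable lborel \<rho>" "\<And>s. 0 \<le> \<rho> s" and m: "mono m"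
    and f: "\<And>a b. a \<le> b \<Longrightarrow> norm (f b - f a) \<le> exp (- m a) * (LINT s:{a..b}|lborel. \<rho> s)"
  obtains l where "\<And>\<tau>. norm (f \<tau> - l) \<le> exp (- m \<tau>) * (LINT s:{\<tau>..}|lborel. \<rho> s)"
proof -
  have refl: "{x. - x \<in> {a..b}} = {- b..- a}" "{x. - x \<in> {..a}} = {- a..}" for a b :: real
    by auto
  have 1: "integrable lborel (\<lambda>s. \<rho> (- s))"
    using lborel_integrable_real_affine[OF \<rho>(1), of "- 1" 0] by simp
  have 2: "mono (\<lambda>s. - m (- s))"
    using m by (auto simp: mono_def)
  have 3: "norm (f (- b) - f (- a)) \<le> exp (- m (- b)) * (LINT s:{a..b}|lborel. \<rho> (- s))"
    if "a \<le> b" for a b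
    using f[of "- b" "- a"] that
    by (subst set_integral_reflect) (use refl in \<open>simp add: norm_minus_commute\<close>)
  obtain l where "\<And>\<tau>. norm (f (- \<tau>) - l) \<le> exp (- m (- \<tau>)) * (LINT s:{..\<tau>}|lborel. \<rho> (- s))"
    using limit_at_left_end[OF 1 \<rho>(2) 2 3] by blast
  then have "norm (f \<tau> - l) \<le> exp (- m \<tau>) * (LINT s:{\<tau>..}|lborel. \<rho> s)" for \<tau>
    by (metis (no_types, lifting) ext minus_minus refl(2) set_integral_reflect)
  then show thesis
    using that by blast
qed

text \<open>The recurring device for second derivatives: near \<open>z\<close> the function
  \<open>deriv f\<close> coincides with an explicit \<open>g\<close>, whose derivative follows from
  the differentiation rules.\<close>

lemma has_field_derivative_deriv:
  assumes "open D" "\<And>w. w \<in> D \<Longrightarrow> (f has_field_derivative g w) (at w)"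
    "(g has_field_derivative d) (at z)" "z \<in> D"
  shows "(deriv f has_field_derivative d) (at z)"
  using assms(2) by (intro has_field_derivative_transform_within_open[OF assms(3,1,4)])
    (metis DERIV_imp_deriv)

section \<open>Variation of parameters along a monotone path\<close>

locale monotone_path =
  fixes D :: "complex set" and u :: complex and \<gamma> :: "real \<Rightarrow> complex"
  assumes openD: "open D" and scD: "simply_connected D" and u: "u \<noteq> 0"
    and range: "range \<gamma> \<subseteq> D"
    and deriv_path: "path_derivative \<gamma> (\<lambda>\<tau>. vector_derivative \<gamma> (at \<tau>))"
    and mono_path: "mono (\<lambda>\<tau>. Re (u * \<gamma> \<tau>))"
    and at_top_path: "filterlim (\<lambda>\<tau>. Re (u * \<gamma> \<tau>)) at_top at_top"
    and at_bot_path: "filterlim (\<lambda>\<tau>. Re (u * \<gamma> \<tau>)) at_bot at_bot"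
begin

lemma in_D [simp]: "\<gamma> \<tau> \<in> D"
  using range by auto

lemma connD: "connected D"
  using scD by (rule simply_connected_imp_connected)

lemma cont_path: "continuous_on UNIV \<gamma>"
  using deriv_path by (simp add: path_derivative_def)

lemma cont_path_hol: "f holomorphic_on D \<Longrightarrow> continuous_on UNIV (\<lambda>\<tau>. f (\<gamma> \<tau>))"
  using continuous_on_compose2[OF holomorphic_on_imp_continuous_on cont_path] range by auto

text \<open>Simple connectivity of \<open>D\<close> turns the integrals of the kernel into
  differences of one single-valued function.\<close>

lemma primitive:
  assumes "f holomorphic_on D"
  obtains F where "\<And>z. z \<in> D \<Longrightarrow> (F has_field_derivative f z) (at z)"
  using assms scD openD by (metis simply_connected_eq_global_primitive)

text \<open>Multiplication by \<psi> carries functions bounded on the path to arc-integrable ones at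
  the cost of the factor \<open>arc_integral \<psi> \<gamma>\<close>. This is one half of the
  contraction estimate; the kernel bound is the other.\<close>

lemma arc_integrable_mult:
  assumes \<psi>: "arc_integrable \<psi> \<gamma>" and f: "f holomorphic_on D" and C: "\<And>\<tau>. norm (f (\<gamma> \<tau>)) \<le> C"
  shows "arc_integrable (\<lambda>z. \<psi> z * f z) \<gamma>"
    and "arc_integral (\<lambda>z. \<psi> z * f z) \<gamma> \<le> C * arc_integral \<psi> \<gamma>"
proof -
  have eq: "arc_density (\<lambda>z. \<psi> z * f z) \<gamma> = (\<lambda>\<tau>. norm (f (\<gamma> \<tau>)) * arc_density \<psi> \<gamma> \<tau>)"
    by (simp add: arc_density_def fun_eq_iff norm_mult)
  have i\<psi>: "integrable lborel (arc_density \<psi> \<gamma>)"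
    using \<psi> by (simp add: arc_integrable_def)
  have le: "norm (f (\<gamma> \<tau>)) * arc_density \<psi> \<gamma> \<tau> \<le> C * arc_density \<psi> \<gamma> \<tau>" for \<tau>
    using C by (intro mult_right_mono) (auto simp: arc_density_def)
  have m: "(\<lambda>\<tau>. norm (f (\<gamma> \<tau>))) \<in> borel_measurable borel"
    using cont_path_hol[OF f] by (intro borel_measurable_continuous_onI continuous_on_norm)
  have i: "integrable lborel (\<lambda>\<tau>. norm (f (\<gamma> \<tau>)) * arc_density \<psi> \<gamma> \<tau>)"
  proof (rule Bochner_Integration.integrable_bound)
    show "integrable lborel (\<lambda>\<tau>. C * arc_density \<psi> \<gamma> \<tau>)" using i\<psi> by simp
    show "(\<lambda>\<tau>. norm (f (\<gamma> \<tau>)) * arc_density \<psi> \<gamma> \<tau>) \<in> borel_measurable lborel"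
      using m borel_measurable_integrable[OF i\<psi>] by simp
  qed (use order_trans[OF le abs_ge_self] in \<open>auto simp: arc_density_def\<close>)
  then show "arc_integrable (\<lambda>z. \<psi> z * f z) \<gamma>"
    unfolding arc_integrable_def eq .
  show "arc_integral (\<lambda>z. \<psi> z * f z) \<gamma> \<le> C * arc_integral \<psi> \<gamma>"
    unfolding arc_integral_def eq
    using integral_mono[OF i _ le] i\<psi> by simp
qed

text \<open>For \<open>v = -(p + q) / (2 u)\<close> this gives $v'' = u^2 v + g$: the functions \<open>p\<close> and \<open>q\<close> are
  $\int_{\alpha_1}^{\xi} e^{u(t-\xi)} g\,dt$ and $\int_{\xi}^{\alpha_2} e^{u(\xi-t)} g\,dt$, whose kernels
  are bounded by 1 along the path because $\mathrm{Re}(ut)$ is monotonic.\<close>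

lemma resolvent:
  assumes g: "g holomorphic_on D" and ig: "arc_integrable g \<gamma>"
  obtains p q where
    "\<And>z. z \<in> D \<Longrightarrow> (p has_field_derivative g z - u * p z) (at z)"
    "\<And>z. z \<in> D \<Longrightarrow> (q has_field_derivative u * q z - g z) (at z)"
    "\<And>\<tau>. norm (p (\<gamma> \<tau>)) + norm (q (\<gamma> \<tau>)) \<le> arc_integral g \<gamma>"
proof -
  define \<rho> where "\<rho> = arc_density g \<gamma>"
  define m where "m \<tau> = Re (u * \<gamma> \<tau>)" for \<tau>
  have m: "mono m" using mono_path by (simp add: m_def[abs_def])
  have \<rho>: "integrable lborel \<rho>" "\<And>s. 0 \<le> \<rho> s"
    using ig by (auto simp: \<rho>_def arc_integrable_def arc_density_def)
  obtain P where P: "\<And>z. z \<in> D \<Longrightarrow> (P has_field_derivative exp (u * z) * g z) (at z)"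
    by (rule primitive[of "\<lambda>z. exp (u * z) * g z"]) (auto intro!: holomorphic_intros g)
  obtain Q where Q: "\<And>z. z \<in> D \<Longrightarrow> (Q has_field_derivative exp (- (u * z)) * g z) (at z)"
    by (rule primitive[of "\<lambda>z. exp (- (u * z)) * g z"]) (auto intro!: holomorphic_intros g)
  have hol: "P holomorphic_on D" "Q holomorphic_on D"
    using P Q openD by (auto simp: holomorphic_on_open)
  have dP: "deriv P (\<gamma> s) = exp (u * \<gamma> s) * g (\<gamma> s)" 
    and dQ: "deriv Q (\<gamma> s) = exp (- (u * \<gamma> s)) * g (\<gamma> s)" for s
    using P Q by (auto intro: DERIV_imp_deriv)
  have "norm (P (\<gamma> b) - P (\<gamma> a)) \<le> exp (m b) * (LINT s:{a..b}|lborel. \<rho> s)" if "a \<le> b" for a b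
  proof -
    have "norm (P (\<gamma> b) - P (\<gamma> a)) \<le> (LINT s:{a..b}|lborel. exp (m b) * \<rho> s)"
    proof (rule increment_bound[OF deriv_path openD range hol(1) that])
      fix s assume "s \<in> {a..b}"
      then have "exp (m s) \<le> exp (m b)" using monoD[OF m] by simp
      then show "norm (deriv P (\<gamma> s)) * norm (vector_derivative \<gamma> (at s)) \<le> exp (m b) * \<rho> s"
        unfolding \<rho>_def arc_density_def dP norm_mult norm_exp_eq_Re m_def mult.assoc
        by (intro mult_right_mono) auto
    qed (use \<rho> in auto)
    then show ?thesis by simp
  qed
  then obtain l where l: "\<And>\<tau>. norm (P (\<gamma> \<tau>) - l) \<le> exp (m \<tau>) * (LINT s:{..\<tau>}|lborel. \<rho> s)"
    using limit_at_left_end[OF \<rho> m, of "\<lambda>s. P (\<gamma> s)"] by blast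
  have "norm (Q (\<gamma> b) - Q (\<gamma> a)) \<le> exp (- m a) * (LINT s:{a..b}|lborel. \<rho> s)" if "a \<le> b" for a b
  proof -
    have "norm (Q (\<gamma> b) - Q (\<gamma> a)) \<le> (LINT s:{a..b}|lborel. exp (- m a) * \<rho> s)"
    proof (rule increment_bound[OF deriv_path openD range hol(2) that])
      fix s assume "s \<in> {a..b}"
      then have "exp (- m s) \<le> exp (- m a)" using monoD[OF m] by simp
      then show "norm (deriv Q (\<gamma> s)) * norm (vector_derivative \<gamma> (at s)) \<le> exp (- m a) * \<rho> s"
        unfolding \<rho>_def arc_density_def dQ norm_mult norm_exp_eq_Re m_def mult.assoc
        by (intro mult_right_mono) auto
    qed (use \<rho> in auto)
    then show ?thesis by simp
  qed
  then obtain l' where l': "\<And>\<tau>. norm (Q (\<gamma> \<tau>) - l') \<le> exp (- m \<tau>) * (LINT s:{\<tau>..}|lborel. \<rho> s)"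
    using limit_at_right_end[OF \<rho> m, of "\<lambda>s. Q (\<gamma> s)"] by blast
  \<comment> \<open>\<open>l\<close> and \<open>l'\<close> are the limits of the primitives at the
    two infinite ends, so \<open>P z - l\<close> and \<open>l' - Q z\<close> are the integrals from
    \<alpha>_1 and up to \<alpha>_2.\<close>
  define p where "p z = exp (- (u * z)) * (P z - l)" for z
  define q where "q z = exp (u * z) * (l' - Q z)" for z
  show thesis
  proof (rule that)
    fix z assume z: "z \<in> D"
    have "exp (u * z) * exp (- (u * z)) = 1" by (simp add: exp_minus)
    then show "(p has_field_derivative g z - u * p z) (at z)"
      "(q has_field_derivative u * q z - g z) (at z)"
      unfolding p_def[abs_def] q_def[abs_def]
      by (auto intro!: derivative_eq_intros P Q z simp: algebra_simps) 
  next
    fix \<tau>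
    have "norm (p (\<gamma> \<tau>)) \<le> exp (- m \<tau>) * (exp (m \<tau>) * (LINT s:{..\<tau>}|lborel. \<rho> s))"
      unfolding p_def norm_mult norm_exp_eq_Re
      using l[of \<tau>] by (intro mult_mono) (auto simp: m_def)
    also have "\<dots> = (LINT s:{..\<tau>}|lborel. \<rho> s)" by (simp add: exp_minus)
    finally have 1: "norm (p (\<gamma> \<tau>)) \<le> (LINT s:{..\<tau>}|lborel. \<rho> s)" .
    have "norm (q (\<gamma> \<tau>)) \<le> exp (m \<tau>) * (exp (- m \<tau>) * (LINT s:{\<tau>..}|lborel. \<rho> s))"
      unfolding q_def norm_mult norm_exp_eq_Re
      using l'[of \<tau>] by (intro mult_mono) (auto simp: m_def norm_minus_commute)
    also have "\<dots> = (LINT s:{\<tau>..}|lborel. \<rho> s)" by (simp add: exp_minus)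
    finally have 2: "norm (q (\<gamma> \<tau>)) \<le> (LINT s:{\<tau>..}|lborel. \<rho> s)" .
    \<comment> \<open>The half-lines overlap in a single point, a null set. Hence the two bounds add
      up to one full arc integral, and the contraction factor is
      \<open>arc_integral \<psi> \<gamma> / (2 * norm u)\<close> rather than twice that.\<close>
    have "(LINT s:{..\<tau>} \<union> {\<tau>..}|lborel. \<rho> s) = 
          (LINT s:{..\<tau>}|lborel. \<rho> s) + (LINT s:{\<tau>..}|lborel. \<rho> s)"
    proof (rule set_integral_Un_AE)
      show "AE x in lborel. \<not> (x \<in> {..\<tau>} \<and> x \<in> {\<tau>..})"
        using AE_lborel_singleton[of \<tau>] by eventually_elim auto
    qed (unfold set_integrable_def, auto intro!: integrable_mult_indicator \<rho>(1) simp del: real_scaleR_def)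
    moreover have "{..\<tau>} \<union> {\<tau>..} = UNIV" by auto
    ultimately show "norm (p (\<gamma> \<tau>)) + norm (q (\<gamma> \<tau>)) \<le> arc_integral g \<gamma>"
      using 1 2 by (simp add: arc_integral_def \<rho>_def set_lebesgue_integral_def)
  qed
qed

text \<open>At the right end the first exponential is unbounded while the second tends to 0; at the
  left end the roles are exchanged. So a nonzero coefficient contradicts the bound.\<close>

lemma bounded_exponentials_vanish:
  assumes C: "\<And>\<tau>. norm (A * exp (u * \<gamma> \<tau>) - B * exp (- (u * \<gamma> \<tau>))) \<le> C"
  shows "A = 0" "B = 0"
proof -
  have nA: "norm (A * exp (u * \<gamma> \<tau>)) = norm A * exp (Re (u * \<gamma> \<tau>))"
    and nB: "norm (B * exp (- (u * \<gamma> \<tau>))) = norm B * exp (- Re (u * \<gamma> \<tau>))" for \<tau>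
    unfolding norm_mult norm_exp_eq_Re by simp_all
  have A: "norm A * exp (Re (u * \<gamma> \<tau>)) \<le> C + norm B * exp (- Re (u * \<gamma> \<tau>))" for \<tau>
    using C[of \<tau>] norm_triangle_sub[of "A * exp (u * \<gamma> \<tau>)" "B * exp (- (u * \<gamma> \<tau>))"]
    unfolding nA nB by linarith
  have B: "norm B * exp (- Re (u * \<gamma> \<tau>)) \<le> C + norm A * exp (Re (u * \<gamma> \<tau>))" for \<tau>
    using C[of \<tau>] norm_triangle_sub[of "B * exp (- (u * \<gamma> \<tau>))" "A * exp (u * \<gamma> \<tau>)"]
    unfolding nA nB norm_minus_commute[of "B * _"] by linarith
  show "A = 0"
  proof (rule ccontr)
    \<comment> \<open>With x = Re (u \<gamma>), the threshold below makes |A| x at least C + |B| +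
      1, and e^x exceeds x; the maximum with 0 keeps e^(-x) at most 1.\<close>
    assume "A \<noteq> 0"
    have "\<forall>\<^sub>F \<tau> in at_top. Re (u * \<gamma> \<tau>) \<ge> max 0 ((C + norm B + 1) / norm A)"
      using at_top_path unfolding filterlim_at_top by blast
    then obtain \<tau> where \<tau>: "Re (u * \<gamma> \<tau>) \<ge> max 0 ((C + norm B + 1) / norm A)"
      by (metis eventually_happens trivial_limit_at_top_linorder)
    then have "C + norm B + 1 \<le> norm A * Re (u * \<gamma> \<tau>)"
      using \<open>A \<noteq> 0\<close> by (simp add: pos_divide_le_eq mult.commute)
    also have "\<dots> \<le> norm A * exp (Re (u * \<gamma> \<tau>))"
      using exp_ge_add_one_self[of "Re (u * \<gamma> \<tau>)"] by (intro mult_left_mono) (auto simp del: exp_ge_add_one_self)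
    also have "\<dots> \<le> C + norm B * exp (- Re (u * \<gamma> \<tau>))" by (rule A)
    also have "\<dots> \<le> C + norm B * 1"
      using \<tau> by (intro add_left_mono mult_left_mono) auto
    finally show False by simp
  qed
  show "B = 0"
  proof (rule ccontr)
    assume "B \<noteq> 0"
    have "\<forall>\<^sub>F \<tau> in at_bot. Re (u * \<gamma> \<tau>) \<le> - max 0 ((C + norm A + 1) / norm B)"
      using at_bot_path unfolding filterlim_at_bot by blast
    then obtain \<tau> where "Re (u * \<gamma> \<tau>) \<le> - max 0 ((C + norm A + 1) / norm B)"
      using eventually_happens trivial_limit_at_bot_linorder by blast
    then have \<tau>: "- Re (u * \<gamma> \<tau>) \<ge> max 0 ((C + norm A + 1) / norm B)"
      by linarith
    then have "C + norm A + 1 \<le> norm B * - Re (u * \<gamma> \<tau>)"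
      using \<open>B \<noteq> 0\<close> by (simp add: pos_divide_le_eq mult.commute)
    also have "\<dots> \<le> norm B * exp (- Re (u * \<gamma> \<tau>))"
      using exp_ge_add_one_self[of "- Re (u * \<gamma> \<tau>)"] by (intro mult_left_mono) (auto simp del: exp_ge_add_one_self)
    also have "\<dots> \<le> C + norm A * exp (Re (u * \<gamma> \<tau>))" by (rule B)
    also have "\<dots> \<le> C + norm A * 1"
      using \<tau> by (intro add_left_mono mult_left_mono) auto
    finally show False by simp
  qed
qed

text \<open>Factoring d'' - u^2 d into first-order operators gives two first integrals, (d' + u d)
  e^(-uz) and (d' - u d) e^(uz). Their constant values A and B recover d through 2 u d = A e^(uz) -
  B e^(-uz), to which boundedness on the path applies.\<close>

lemma bounded_free_solution_zero:
  assumes d: "d holomorphic_on D" "\<And>z. z \<in> D \<Longrightarrow> deriv (deriv d) z = u\<^sup>2 * d z"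
    and C: "\<And>\<tau>. norm (d (\<gamma> \<tau>)) \<le> C" and z: "z \<in> D"
  shows "d z = 0"
proof -
  have d1: "(d has_field_derivative deriv d z) (at z)" if "z \<in> D" for z
    using d(1) openD that by (rule holomorphic_derivI)
  have d2: "(deriv d has_field_derivative u\<^sup>2 * d z) (at z)" if "z \<in> D" for z
    using d that openD holomorphic_derivI[OF holomorphic_deriv] by metis
  have ee: "exp (u * z) * exp (- (u * z)) = 1" for z by (simp add: exp_minus)
  have "\<exists>A. \<forall>z\<in>D. (deriv d z + u * d z) * exp (- (u * z)) = A"
  proof -
    have "(\<lambda>z. (deriv d z + u * d z) * exp (- (u * z))) constant_on D"
      by (rule has_field_derivative_0_imp_constant_on[OF _ connD openD])
         (auto intro!: derivative_eq_intros d1 d2 simp: algebra_simps power2_eq_square)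
    then show ?thesis unfolding constant_on_def by blast
  qed
  then obtain A where A: "\<And>z. z \<in> D \<Longrightarrow> (deriv d z + u * d z) * exp (- (u * z)) = A" by blast
  have "\<exists>B. \<forall>z\<in>D. (deriv d z - u * d z) * exp (u * z) = B"
  proof -
    have "(\<lambda>z. (deriv d z - u * d z) * exp (u * z)) constant_on D"
      by (rule has_field_derivative_0_imp_constant_on[OF _ connD openD])
         (auto intro!: derivative_eq_intros d1 d2 simp: algebra_simps power2_eq_square)
    then show ?thesis unfolding constant_on_def by blast
  qed
  then obtain B where B: "\<And>z. z \<in> D \<Longrightarrow> (deriv d z - u * d z) * exp (u * z) = B" by blast
  have AB: "2 * u * d z = A * exp (u * z) - B * exp (- (u * z))" if "z \<in> D" for z
  proof -
    have "A * exp (u * z) = deriv d z + u * d z"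
      using A[OF that] ee[of z] by (metis mult.assoc mult.commute mult.right_neutral)
    moreover have "B * exp (- (u * z)) = deriv d z - u * d z"
      using B[OF that] ee[of z] by (metis mult.assoc mult.right_neutral)
    ultimately show ?thesis by simp
  qed
  have "norm (A * exp (u * \<gamma> \<tau>) - B * exp (- (u * \<gamma> \<tau>))) \<le> 2 * norm u * C" for \<tau>
    unfolding AB[OF in_D, symmetric] norm_mult using C[of \<tau>] by (simp add: mult_left_mono)
  then have "A = 0" "B = 0"
    using bounded_exponentials_vanish by blast+
  then show ?thesis
    using AB[OF z] u by simp
qed

text \<open>One application of the contraction, with v = -(p + q) / (2u). Its derivative (p - q) / 2
  is built from the same two functions and obeys the same bound up to the factor |u|. Written with
  \<open>norm u * C\<close>, values and derivatives can be iterated with one common ratio.\<close>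

lemma resolvent_solution:
  assumes \<psi>: "\<psi> holomorphic_on D" "arc_integrable \<psi> \<gamma>" and f: "f holomorphic_on D"
    and C: "\<And>\<tau>. norm (f (\<gamma> \<tau>)) \<le> C"
  shows "\<exists>v. v holomorphic_on D \<and>
    (\<forall>z\<in>D. (deriv v has_field_derivative u\<^sup>2 * v z + \<psi> z * f z) (at z)) \<and>
    (\<forall>\<tau>. norm (v (\<gamma> \<tau>)) \<le> arc_integral \<psi> \<gamma> / (2 * norm u) * C) \<and>
    (\<forall>\<tau>. norm (deriv v (\<gamma> \<tau>)) \<le> arc_integral \<psi> \<gamma> / (2 * norm u) * (norm u * C))"
proof -
  obtain p q where
    p: "\<And>z. z \<in> D \<Longrightarrow> (p has_field_derivative \<psi> z * f z - u * p z) (at z)" and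
    q: "\<And>z. z \<in> D \<Longrightarrow> (q has_field_derivative u * q z - \<psi> z * f z) (at z)" and
    pq: "\<And>\<tau>. norm (p (\<gamma> \<tau>)) + norm (q (\<gamma> \<tau>)) \<le> arc_integral (\<lambda>z. \<psi> z * f z) \<gamma>"
    by (rule resolvent[of "\<lambda>z. \<psi> z * f z"])
       (auto intro!: holomorphic_intros \<psi> f arc_integrable_mult(1) C)
  define v where "v z = - (p z + q z) / (2 * u)" for z
  have v1: "(v has_field_derivative (p z - q z) / 2) (at z)" if "z \<in> D" for z
    unfolding v_def[abs_def]
    by (rule derivative_eq_intros p q that refl)+ (use u in \<open>auto simp: field_simps\<close>)
  have v2: "(deriv v has_field_derivative u\<^sup>2 * v z + \<psi> z * f z) (at z)" if "z \<in> D" for z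
  proof -
    have "((\<lambda>z. (p z - q z) / 2) has_field_derivative u\<^sup>2 * v z + \<psi> z * f z) (at z)"
      by (rule derivative_eq_intros p q that refl)+
         (use u in \<open>auto simp: field_simps v_def power2_eq_square\<close>)
    then show ?thesis
      using has_field_derivative_deriv[OF openD v1] that by blast
  qed
  have vh: "v holomorphic_on D" using v1 openD by (auto simp: holomorphic_on_open)
  have pqC: "norm (p (\<gamma> \<tau>)) + norm (q (\<gamma> \<tau>)) \<le> C * arc_integral \<psi> \<gamma>" for \<tau>
    using pq[of \<tau>] arc_integrable_mult(2)[OF \<psi>(2) f C] by linarith
  have vb: "norm (v (\<gamma> \<tau>)) \<le> arc_integral \<psi> \<gamma> / (2 * norm u) * C" for \<tau>
  proof -
    have "norm (p (\<gamma> \<tau>) + q (\<gamma> \<tau>)) \<le> C * arc_integral \<psi> \<gamma>"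
      using pqC[of \<tau>] norm_triangle_ineq[of "p (\<gamma> \<tau>)" "q (\<gamma> \<tau>)"] by linarith
    moreover have "norm (v (\<gamma> \<tau>)) = norm (p (\<gamma> \<tau>) + q (\<gamma> \<tau>)) / (2 * norm u)"
      unfolding v_def norm_divide norm_minus_cancel norm_mult by simp
    ultimately show ?thesis by (simp add: divide_right_mono mult.commute)
  qed
  have vb': "norm (deriv v (\<gamma> \<tau>)) \<le> arc_integral \<psi> \<gamma> / (2 * norm u) * (norm u * C)" for \<tau>
  proof -
    have "norm (p (\<gamma> \<tau>) - q (\<gamma> \<tau>)) \<le> C * arc_integral \<psi> \<gamma>"
      using pqC[of \<tau>] norm_triangle_ineq4[of "p (\<gamma> \<tau>)" "q (\<gamma> \<tau>)"] by linarith
    then show ?thesis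
      unfolding DERIV_imp_deriv[OF v1[OF in_D]] using u by (simp add: norm_divide mult.commute)
  qed
  show ?thesis using vh v2 vb vb' by (intro exI[of _ v]) simp
qed

lemma bounded_homogeneous_solution_zero:
  assumes \<psi>: "\<psi> holomorphic_on D" "arc_integrable \<psi> \<gamma>" "arc_integral \<psi> \<gamma> < 2 * norm u"
    and h: "h holomorphic_on D" "\<And>z. z \<in> D \<Longrightarrow> deriv (deriv h) z = (u\<^sup>2 + \<psi> z) * h z"
    and C: "\<And>\<tau>. norm (h (\<gamma> \<tau>)) \<le> C" and z: "z \<in> D"
  shows "h z = 0"
proof -
  define S where "S = (SUP \<tau>. norm (h (\<gamma> \<tau>)))"
  have bdd: "bdd_above (range (\<lambda>\<tau>. norm (h (\<gamma> \<tau>))))" using C by (auto intro!: bdd_aboveI2)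
  have S: "norm (h (\<gamma> \<tau>)) \<le> S" for \<tau>
    unfolding S_def by (rule cSUP_upper[OF _ bdd]) simp
  have S0: "S \<ge> 0" using S[of 0] norm_ge_zero order_trans by blast
  obtain v where vh: "v holomorphic_on D" and
    v2: "\<And>z. z \<in> D \<Longrightarrow> (deriv v has_field_derivative u\<^sup>2 * v z + \<psi> z * h z) (at z)" and
    vb: "\<And>\<tau>. norm (v (\<gamma> \<tau>)) \<le> arc_integral \<psi> \<gamma> / (2 * norm u) * S"
    using resolvent_solution[OF \<psi>(1,2) h(1) S] by auto
  have dd: "deriv (deriv (\<lambda>z. h z - v z)) w = u\<^sup>2 * (h w - v w)" if w: "w \<in> D" for w
  proof -
    have "((\<lambda>z. h z - v z) has_field_derivative deriv h x - deriv v x) (at x)" if "x \<in> D" for x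
      using holomorphic_derivI[OF h(1) openD that] holomorphic_derivI[OF vh openD that]
      by (rule DERIV_diff)
    moreover have "((\<lambda>x. deriv h x - deriv v x) has_field_derivative
        (u\<^sup>2 + \<psi> w) * h w - (u\<^sup>2 * v w + \<psi> w * h w)) (at w)"
      using holomorphic_derivI[OF holomorphic_deriv[OF h(1) openD] openD w] h(2)[OF w]
      by (intro DERIV_diff v2[OF w]) simp
    ultimately have "(deriv (\<lambda>z. h z - v z) has_field_derivative
        (u\<^sup>2 + \<psi> w) * h w - (u\<^sup>2 * v w + \<psi> w * h w)) (at w)"
      by (rule has_field_derivative_deriv[OF openD _ _ w])
    then show ?thesis
      by (simp add: DERIV_imp_deriv algebra_simps)
  qed
  have d0: "h z - v z = 0" if "z \<in> D" for z
  proof (rule bounded_free_solution_zero[OF _ dd _ that])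
    show "(\<lambda>z. h z - v z) holomorphic_on D" by (intro holomorphic_intros h vh)
    show "norm (h (\<gamma> \<tau>) - v (\<gamma> \<tau>)) \<le> C + arc_integral \<psi> \<gamma> / (2 * norm u) * S" for \<tau>
      using C[of \<tau>] vb[of \<tau>] norm_triangle_ineq4[of "h (\<gamma> \<tau>)" "v (\<gamma> \<tau>)"] by linarith
  qed
  \<comment> \<open>On the path \<open>h\<close> coincides with \<open>v\<close>, so the supremum
    satisfies S \<le> \<kappa> S, where \<kappa> < 1 is the contraction factor.\<close>
  have "S \<le> arc_integral \<psi> \<gamma> / (2 * norm u) * S"
    unfolding S_def using d0[OF in_D] vb by (intro cSUP_least) (auto simp: S_def)
  then have "S * (2 * norm u) \<le> S * arc_integral \<psi> \<gamma>"
    using u by (simp add: pos_le_divide_eq mult.commute)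
  then have "S = 0"
    using \<psi>(3) S0 mult_strict_left_mono[OF \<psi>(3), of S] by linarith
  then have h0: "h (\<gamma> \<tau>) = 0" for \<tau> using S[of \<tau>] by simp
  \<comment> \<open>So far \<open>h\<close> vanishes on the path only. The path is connected and, Re
    (u \<gamma>) being unbounded, more than one point; so it has no isolated points and the identity
    theorem reaches all of \<open>D\<close>.\<close>
  have "\<gamma> 0 islimpt range \<gamma>"
  proof (rule connected_imp_perfect)
    show "connected (range \<gamma>)" using cont_path connected_UNIV by (rule connected_continuous_image)
    have "\<forall>\<^sub>F \<tau> in at_top. Re (u * \<gamma> \<tau>) > Re (u * \<gamma> 0)"
      using at_top_path unfolding filterlim_at_top_dense by blast
    then obtain \<tau> where "Re (u * \<gamma> \<tau>) > Re (u * \<gamma> 0)"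
      by (metis eventually_happens trivial_limit_at_top_linorder)
    then have "\<gamma> \<tau> \<noteq> \<gamma> 0" by auto
    then show "range \<gamma> \<noteq> {x}" for x by (metis rangeI singletonD)
  qed simp
  then show ?thesis
    by (intro analytic_continuation[OF h(1) openD connD range in_D _ _ z]) (use h0 in auto)
qed

end

section \<open>Chains of derivatives along an unbounded path\<close>

text \<open>Stability of interpolation at separated nodes in the unit disc, with \<open>K\<close>
  depending on \<open>N\<close> and \<sigma> alone. Dividing out the last node leaves a quotient of
  lower degree whose values at the other nodes are at most 2B / \<sigma>, so induction applies to
  it.\<close>

lemma poly_coeff_bound:
  fixes \<sigma> :: real
  assumes "\<sigma> > 0"
  shows "\<exists>K\<ge>0. \<forall>(p::complex poly) t B. (\<forall>i\<ge>N. coeff p i = 0) \<longrightarrow>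
    (\<forall>j<N. norm (t j) \<le> 1 \<and> norm (poly p (t j)) \<le> B) \<longrightarrow>
    (\<forall>j<N. \<forall>k<N. j \<noteq> k \<longrightarrow> \<sigma> \<le> norm (t j - t k)) \<longrightarrow> 0 \<le> B \<longrightarrow>
    (\<forall>i. norm (coeff p i) \<le> K * B)"
proof (induction N)
  case 0
  show ?case by (intro exI[of _ 0]) auto
next
  case (Suc N)
  then obtain K where K0: "K \<ge> 0" and K: "\<And>(p::complex poly) t B. \<lbrakk>\<forall>i\<ge>N. coeff p i = 0;
    \<forall>j<N. norm (t j) \<le> 1 \<and> norm (poly p (t j)) \<le> B;
    \<forall>j<N. \<forall>k<N. j \<noteq> k \<longrightarrow> \<sigma> \<le> norm (t j - t k); 0 \<le> B\<rbrakk> \<Longrightarrow>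
    (\<forall>i. norm (coeff p i) \<le> K * B)"
    by metis
  show ?case
  \<comment> \<open>Reassembling p = (X - a) q + p(a) costs at most B + 2 K (2B / \<sigma>), because
    |a| \<le> 1.\<close>
  proof (intro exI[of _ "1 + 4 * K / \<sigma>"] conjI allI impI)
    show "0 \<le> 1 + 4 * K / \<sigma>" using K0 assms by simp
    fix p :: "complex poly" and t :: "nat \<Rightarrow> complex" and B :: real and i :: nat
    assume deg: "\<forall>i\<ge>Suc N. coeff p i = 0"
      and t: "\<forall>j<Suc N. norm (t j) \<le> 1 \<and> norm (poly p (t j)) \<le> B"
      and sep: "\<forall>j<Suc N. \<forall>k<Suc N. j \<noteq> k \<longrightarrow> \<sigma> \<le> norm (t j - t k)" and B: "0 \<le> B"
    define a where "a = t N"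
    define q where "q = synthetic_div p a"
    have p: "p = [:- a, 1:] * q + [:poly p a:]"
      unfolding q_def by (rule synthetic_div_correct'[symmetric])
    have degp: "degree p \<le> N" using deg by (intro degree_le) auto
    have degq: "coeff q i = 0" if "i \<ge> N" for i
    proof (cases "degree p = 0")
      case True
      then have "q = 0" unfolding q_def by (simp add: synthetic_div_eq_0_iff)
      then show ?thesis by simp
    next
      case False
      then have "degree q < i"
        using degp that unfolding q_def degree_synthetic_div by linarith
      then show ?thesis by (rule coeff_eq_0)
    qed
    have q: "norm (coeff q i) \<le> K * (2 * B / \<sigma>)" for i
    proof -
      have "norm (poly q (t j)) \<le> 2 * B / \<sigma>" if "j < N" for j
      proof -
        have "poly p (t j) = (t j - a) * poly q (t j) + poly p a"
          by (subst p) (simp add: algebra_simps)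
        then have "norm ((t j - a) * poly q (t j)) \<le> B + B"
          using t that norm_triangle_ineq4[of "poly p (t j)" "poly p a"] unfolding a_def by (smt (verit) add_diff_cancel_right' less_Suc_eq)
        moreover have "\<sigma> * norm (poly q (t j)) \<le> norm ((t j - a) * poly q (t j))"
          unfolding norm_mult a_def using sep that by (intro mult_right_mono) auto
        ultimately show ?thesis using assms by (simp add: pos_le_divide_eq mult.commute)
      qed
      then show ?thesis
        using K[of q t "2 * B / \<sigma>"] degq t sep B assms by auto
    qed
    have "coeff p i = (case i of 0 \<Rightarrow> poly p a | Suc k \<Rightarrow> coeff q k) - a * coeff q i"
      by (subst p) (simp add: coeff_pCons split: nat.split)
    then have "norm (coeff p i) \<le> norm (case i of 0 \<Rightarrow> poly p a | Suc k \<Rightarrow> coeff q k) + norm (a * coeff q i)"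
      by (simp add: norm_triangle_ineq4)
    also have "norm (a * coeff q i) \<le> 1 * (K * (2 * B / \<sigma>))"
      unfolding norm_mult using t q by (intro mult_mono) (auto simp: a_def)
    also have "norm (case i of 0 \<Rightarrow> poly p a | Suc k \<Rightarrow> coeff q k) \<le> B + K * (2 * B / \<sigma>)"
    proof (cases i)
      case 0
      have "norm (poly p a) \<le> B" using t by (auto simp: a_def)
      moreover have "0 \<le> K * (2 * B / \<sigma>)" using K0 B assms by simp
      ultimately show ?thesis using 0 by simp
    next
      case (Suc k)
      then show ?thesis using q[of k] B by simp
    qed
    finally show "norm (coeff p i) \<le> (1 + 4 * K / \<sigma>) * B"
      by (simp add: algebra_simps)
  qed
qed

text \<open>The largest solution of f = c works: a later value above \<open>c\<close> would have to
  cross \<open>c\<close> again, since f b \<le> c. For the distance to a point this yields a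
  position on a given circle after which the path stays in the closed disc up to
  \<open>b\<close>.\<close>

lemma last_exit:
  fixes f :: "real \<Rightarrow> real"
  assumes f: "continuous_on {a..b} f" and "a \<le> b" "f b \<le> c" "c \<le> f a"
  shows "\<exists>s. a \<le> s \<and> s \<le> b \<and> f s = c \<and> (\<forall>x. s \<le> x \<longrightarrow> x \<le> b \<longrightarrow> f x \<le> c)"
proof -
  define S where "S = {s \<in> {a..b}. f s = c}"
  have "S = {a..b} \<inter> f -` {c}" by (auto simp: S_def)
  then have "closed S"
    using f by (simp add: continuous_closed_preimage)
  moreover have "bounded S"
    by (rule bounded_subset[of "{a..b}"]) (auto simp: S_def)
  ultimately have "compact S"
    by (simp add: compact_eq_bounded_closed)
  moreover have "S \<noteq> {}"
    using IVT2'[of f b c a] assms by (auto simp: S_def)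
  ultimately obtain s where s: "s \<in> S" "\<And>x. x \<in> S \<Longrightarrow> x \<le> s"
    by (metis compact_attains_sup)
  have "f x \<le> c" if sx: "s \<le> x" "x \<le> b" for x
  proof (rule ccontr)
    assume "\<not> f x \<le> c"
    moreover have "continuous_on {x..b} f"
      using f s(1) sx by (auto simp: S_def intro: continuous_on_subset)
    ultimately obtain y where y: "x \<le> y" "y \<le> b" "f y = c"
      using IVT2'[of f b c x] assms sx by auto
    then have "y \<in> S" using s(1) sx by (auto simp: S_def)
    then have "y \<le> s" by (rule s(2))
    then have "x = s" using y sx by simp
    then show False using s(1) \<open>\<not> f x \<le> c\<close> by (simp add: S_def)
  qed
  then show ?thesis
    using s(1) by (auto simp: S_def)
qed

text \<open>Taylor's sum telescopes when its base point moves: differentiating a power of t - s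
  cancels the preceding term of an exact chain of derivatives. What is left are the defects
  \<open>y' j - y (Suc j) s\<close> of the chain and the last derivative.\<close>

lemma taylor_shift_derivative:
  fixes y :: "nat \<Rightarrow> complex \<Rightarrow> complex"
  assumes y: "\<And>j. j \<le> N \<Longrightarrow> (y j has_field_derivative y' j) (at s)"
  shows "((\<lambda>s. \<Sum>j\<le>N. y j s * (t - s) ^ j / fact j) has_field_derivative
     (\<Sum>j<N. (y' j - y (Suc j) s) * (t - s) ^ j / fact j) + y' N * (t - s) ^ N / fact N) (at s)"
  using y
proof (induction N)
  case 0
  then show ?case by simp
next
  case (Suc N)
  have "((\<lambda>s. y (Suc N) s * (t - s) ^ Suc N / fact (Suc N)) has_field_derivative
      y' (Suc N) * (t - s) ^ Suc N / fact (Suc N) - y (Suc N) s * (t - s) ^ N / fact N) (at s)"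
  proof -
    have "((\<lambda>s. (t - s) ^ Suc N / fact (Suc N)) has_field_derivative
        (of_nat (Suc N) * (t - s) ^ N * (- 1)) / fact (Suc N)) (at s)"
      by (intro DERIV_cdivide DERIV_power_Suc[THEN DERIV_cong] derivative_eq_intros) auto
    also have "(of_nat (Suc N) * (t - s) ^ N * (- 1)) / fact (Suc N) = - ((t - s) ^ N / fact N)"
      by (simp add: divide_simps del: of_nat_Suc)
    finally show ?thesis
      using DERIV_mult'[OF Suc.prems[OF order_refl]] by (fastforce simp: algebra_simps)
  qed
  from DERIV_add[OF Suc.IH this] Suc.prems show ?case
    by (simp add: algebra_simps diff_divide_distrib)
qed


text \<open>A Landau inequality on a curve. Near a far point \<open>\<xi>\<close> of the path, Taylor's formula represents
  \<open>y 0\<close> as a polynomial with coefficients \<open>y j \<xi> / j!\<close>, up to an error that is bounded plus a small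
  multiple of the \<open>y j\<close>; since the path leaves the unit disc around \<open>\<xi>\<close>, interpolation at \<open>N\<close>
  separated points of the path controls the coefficients. Choosing \<open>\<xi>\<close> where the sum of the
  \<open>norm (y j)\<close> is maximal absorbs the error.\<close>

lemma derivative_chain_bounded:
  fixes y :: "nat \<Rightarrow> complex \<Rightarrow> complex"
  assumes \<gamma>: "path_derivative \<gamma> \<gamma>'" and D: "open D" "range \<gamma> \<subseteq> D"
    and inf: "filterlim (\<lambda>\<tau>. norm (\<gamma> \<tau>)) at_top at_top"
    and N: "N \<ge> 1" and y: "\<And>j. j \<le> N \<Longrightarrow> y j holomorphic_on D"
    and step: "\<And>j z. j < N \<Longrightarrow> z \<in> D \<Longrightarrow>
      norm (deriv (y j) z - y (Suc j) z) \<le> norm (\<psi> z) * (\<Sum>i<N. norm (y i z))"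
    and i1: "integrable lborel (\<lambda>\<tau>. norm (\<psi> (\<gamma> \<tau>)) * norm (\<gamma>' \<tau>))"
    and i2: "integrable lborel (\<lambda>\<tau>. norm (deriv (y N) (\<gamma> \<tau>)) * norm (\<gamma>' \<tau>))"
    and C: "\<And>\<tau>. norm (y 0 (\<gamma> \<tau>)) \<le> C" "\<And>\<tau>. norm (y N (\<gamma> \<tau>)) \<le> C"
  shows "\<exists>M. \<forall>\<tau>\<ge>0. \<forall>j<N. norm (y j (\<gamma> \<tau>)) \<le> M"
proof -
  \<comment> \<open>The radii \<open>real k * \<sigma>\<close> with k < N differ by at least
    \<sigma> and stay below 1/2, so points within these discs are at mutual distance at most
    1.\<close>
  define \<sigma> where "\<sigma> = 1 / (2 * real N)"
  have \<sigma>: "\<sigma> > 0" using N by (simp add: \<sigma>_def)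
  obtain K where K0: "K \<ge> 0" and K: "\<And>(p::complex poly) t B. \<lbrakk>\<forall>i\<ge>N. coeff p i = 0;
    \<forall>j<N. norm (t j) \<le> 1 \<and> norm (poly p (t j)) \<le> B;
    \<forall>j<N. \<forall>k<N. j \<noteq> k \<longrightarrow> \<sigma> \<le> norm (t j - t k); 0 \<le> B\<rbrakk> \<Longrightarrow>
    (\<forall>i. norm (coeff p i) \<le> K * B)"
    using poly_coeff_bound[OF \<sigma>, of N] by metis
  \<comment> \<open>\<open>Q\<close> converts a bound on the \<open>N\<close> coefficients y j / j!
    into one on the sum of the |y j|; \<kappa> is then chosen with Q N \<kappa> \<le> 1/2, so that
    half of that sum can be absorbed.\<close>
  define Q where "Q = real N * fact N * K"
  have Q0: "Q \<ge> 0" using K0 by (simp add: Q_def)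
  define \<kappa> where "\<kappa> = 1 / (2 * (Q * N + 1))"
  have QN: "Q * N + 1 > 0" using Q0 by (smt (verit) mult_nonneg_nonneg of_nat_0_le_iff)
  have \<kappa>: "\<kappa> > 0" using QN by (simp add: \<kappa>_def)
  have Q\<kappa>: "Q * N * \<kappa> \<le> 1 / 2" using QN by (simp add: \<kappa>_def divide_simps)
  define \<rho>1 where "\<rho>1 \<tau> = norm (\<psi> (\<gamma> \<tau>)) * norm (\<gamma>' \<tau>)" for \<tau>
  define \<rho>2 where "\<rho>2 \<tau> = norm (deriv (y N) (\<gamma> \<tau>)) * norm (\<gamma>' \<tau>)" for \<tau>
  have \<rho>: "integrable lborel \<rho>1" "integrable lborel \<rho>2" "\<And>s. 0 \<le> \<rho>1 s" "\<And>s. 0 \<le> \<rho>2 s"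
    using i1 i2 by (auto simp: \<rho>1_def[abs_def] \<rho>2_def[abs_def])
  have "(\<lambda>n. LINT s:{real n..}|lborel. \<rho>1 s) \<longlonglongrightarrow> 0"
  proof (rule set_integral_vanishing[OF \<rho>(1)])
    show "\<forall>\<^sub>F n in sequentially. x \<notin> {real n..}" for x
      using eventually_gt_at_top[of "nat \<lceil>x\<rceil>"] by eventually_elim (auto, linarith)
  qed auto
  then have "\<forall>\<^sub>F n in sequentially. (LINT s:{real n..}|lborel. \<rho>1 s) < \<kappa>"
    using \<kappa> by (rule order_tendstoD(2))
  then obtain n where n: "(LINT s:{real n..}|lborel. \<rho>1 s) < \<kappa>"
    by (auto simp: eventually_sequentially)
  define T0 where "T0 = real n"
  have "\<forall>\<^sub>F \<tau> in at_top. norm (\<gamma> \<tau>) \<ge> norm (\<gamma> T0) + 1"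
    using inf unfolding filterlim_at_top by blast
  then obtain T1 where T1: "\<And>\<tau>. \<tau> \<ge> T1 \<Longrightarrow> norm (\<gamma> \<tau>) \<ge> norm (\<gamma> T0) + 1"
    by (auto simp: eventually_at_top_linorder)
  \<comment> \<open>Beyond \<open>T0\<close> the remaining arc integral of \<psi> is below \<kappa>.
    Beyond \<open>T\<close> the path is at distance at least 1 from its point at \<open>T0\<close>,
    so all circles about it are met after \<open>T0\<close>.\<close>
  define T where "T = max T0 T1"
  define S where "S \<tau> = (\<Sum>i<N. norm (y i (\<gamma> \<tau>)))" for \<tau>
  define C2 where "C2 = (LINT s|lborel. \<rho>2 s)"
  have c\<gamma>: "continuous_on A \<gamma>" for A
    using \<gamma> unfolding path_derivative_def by (auto intro: continuous_on_subset)
  have cS: "continuous_on A S" for A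
    unfolding S_def[abs_def]
    by (intro continuous_intros continuous_on_compose2[OF holomorphic_on_imp_continuous_on[OF y] c\<gamma>])
       (use D in auto)
  have S: "norm (y j (\<gamma> \<tau>)) \<le> S \<tau>" if "j < N" for j \<tau>
    unfolding S_def using that by (intro member_le_sum) auto
  have "compact (S ` {0..T})"
    by (intro compact_continuous_image cS) auto
  then obtain M0 where M0: "\<And>\<tau>. 0 \<le> \<tau> \<Longrightarrow> \<tau> \<le> T \<Longrightarrow> S \<tau> \<le> M0"
    using compact_imp_bounded bounded_imp_bdd_above unfolding bdd_above_def by (metis atLeastAtMost_iff image_eqI)
  define A where "A = Q * (2 * C + C2)"
  have main: "S b \<le> 2 * A" if b: "T0 \<le> b" "T \<le> b" and max: "\<And>s. T0 \<le> s \<Longrightarrow> s \<le> b \<Longrightarrow> S s \<le> S b" for b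
  proof -
    define \<xi> where "\<xi> = \<gamma> b"
    \<comment> \<open>One node on each circle of radius \<open>real k * \<sigma>\<close> about
      \<xi>, for k = 0 the point \<xi> itself; the differing radii separate the nodes.\<close>
    have "\<exists>s. T0 \<le> s \<and> s \<le> b \<and> norm (\<gamma> s - \<xi>) = real k * \<sigma> \<and>
        (\<forall>x. s \<le> x \<longrightarrow> x \<le> b \<longrightarrow> norm (\<gamma> x - \<xi>) \<le> real k * \<sigma>)" if "k < N" for k
    proof -
      have "real k * \<sigma> \<le> 1" using that by (simp add: \<sigma>_def divide_simps)
      also have "1 \<le> norm (\<xi>) - norm (\<gamma> T0)" using T1[of b] b by (simp add: T_def \<xi>_def)
      also have "\<dots> \<le> norm (\<gamma> T0 - \<xi>)" by (metis norm_minus_commute norm_triangle_ineq2)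
      finally have 1: "real k * \<sigma> \<le> norm (\<gamma> T0 - \<xi>)" .
      have 2: "norm (\<gamma> b - \<xi>) \<le> real k * \<sigma>" using \<sigma> by (simp add: \<xi>_def)
      have "continuous_on {T0..b} (\<lambda>s. norm (\<gamma> s - \<xi>))" by (intro continuous_intros c\<gamma>)
      from last_exit[OF this b(1) 2 1] show ?thesis .
    qed
    then obtain e where e: "\<And>k. k < N \<Longrightarrow> T0 \<le> e k" "\<And>k. k < N \<Longrightarrow> e k \<le> b"
      "\<And>k. k < N \<Longrightarrow> norm (\<gamma> (e k) - \<xi>) = real k * \<sigma>"
      "\<And>k x. k < N \<Longrightarrow> e k \<le> x \<Longrightarrow> x \<le> b \<Longrightarrow> norm (\<gamma> x - \<xi>) \<le> real k * \<sigma>"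
      by metis
    have k\<sigma>: "real k * \<sigma> \<le> 1 / 2" if "k < N" for k
      using that by (simp add: \<sigma>_def divide_simps)
    define p where "p = (\<Sum>j<N. monom (y j \<xi> / fact j) j)"
    have pp: "poly p w = (\<Sum>j<N. y j \<xi> * w ^ j / fact j)" for w
      by (simp add: p_def poly_sum poly_monom)
    have pc: "coeff p i = (if i < N then y i \<xi> / fact i else 0)" for i
      by (simp add: p_def coeff_sum)
    define B where "B = 2 * C + C2 + real N * \<kappa> * S b"
    have pb: "norm (poly p (\<gamma> (e k) - \<xi>)) \<le> B" if k: "k < N" for k
    proof -
      define t where "t = \<gamma> (e k)"
      define F where "F s = (\<Sum>j\<le>N. y j s * (t - s) ^ j / fact j)" for s
      have dF: "(F has_field_derivative (\<Sum>j<N. (deriv (y j) s - y (Suc j) s) * (t - s) ^ j / fact j) +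
          deriv (y N) s * (t - s) ^ N / fact N) (at s)" if "s \<in> D" for s
        unfolding F_def[abs_def]
        by (rule taylor_shift_derivative) (use holomorphic_derivI[OF y D(1) that] in auto)
      have hF: "F holomorphic_on D" using dF D(1) by (auto simp: holomorphic_on_open)
      have "norm (F (\<gamma> b) - F (\<gamma> (e k))) \<le> (LINT s:{e k..b}|lborel. real N * S b * \<rho>1 s + \<rho>2 s)"
      proof (rule increment_bound[OF \<gamma> D hF e(2)[OF k]])
        show "integrable lborel (\<lambda>s. real N * S b * \<rho>1 s + \<rho>2 s)" using \<rho> by simp
        fix x assume x: "x \<in> {e k..b}"
        define s where "s = \<gamma> x"
        have s: "s \<in> D" using D by (auto simp: s_def)
        have "norm (t - s) \<le> norm (t - \<xi>) + norm (s - \<xi>)"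
          by (metis dist_norm dist_triangle2)
        also have "\<dots> \<le> 1"
          using e(3,4)[OF k] k\<sigma>[OF k] x by (force simp: t_def s_def)
        finally have ts: "norm (t - s) \<le> 1" .
        have frac: "norm ((t - s) ^ j / fact j) \<le> 1" for j
          using ts fact_ge_1[of j, where 'a=real] power_le_one[OF norm_ge_zero ts, of j]
          by (simp add: norm_divide norm_power divide_le_eq del: fact_ge_1)
        have "norm (deriv F s) \<le> (\<Sum>j<N. norm ((deriv (y j) s - y (Suc j) s) * (t - s) ^ j / fact j)) +
            norm (deriv (y N) s * (t - s) ^ N / fact N)"
          unfolding DERIV_imp_deriv[OF dF[OF s]]
          by (intro order_trans[OF norm_triangle_ineq] add_right_mono norm_sum)
        also have "\<dots> \<le> (\<Sum>j<N. norm (\<psi> s) * S b) + norm (deriv (y N) s)"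
        proof (intro add_mono sum_mono)
          fix j assume j: "j \<in> {..<N}"
          have "norm (deriv (y j) s - y (Suc j) s) \<le> norm (\<psi> s) * S x"
            using step[of j s] s j by (simp add: S_def s_def)
          also have "\<dots> \<le> norm (\<psi> s) * S b"
            using max[of x] x e(1)[OF k] by (intro mult_left_mono) auto
          finally have "norm (deriv (y j) s - y (Suc j) s) * norm ((t - s) ^ j / fact j)
              \<le> norm (\<psi> s) * S b * 1"
            using frac by (intro mult_mono) (auto intro: order_trans[OF norm_ge_zero])
          then show "norm ((deriv (y j) s - y (Suc j) s) * (t - s) ^ j / fact j) \<le> norm (\<psi> s) * S b"
            by (simp add: norm_mult norm_divide)
        next
          show "norm (deriv (y N) s * (t - s) ^ N / fact N) \<le> norm (deriv (y N) s)"
            using mult_left_mono[OF frac[of N], of "norm (deriv (y N) s)"]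
            by (simp add: norm_mult norm_divide)
        qed
        finally have "norm (deriv F s) * norm (\<gamma>' x) \<le>
            (real N * (norm (\<psi> s) * S b) + norm (deriv (y N) s)) * norm (\<gamma>' x)"
          by (intro mult_right_mono) auto
        then show "norm (deriv F (\<gamma> x)) * norm (\<gamma>' x) \<le> real N * S b * \<rho>1 x + \<rho>2 x"
          by (simp add: \<rho>1_def \<rho>2_def s_def algebra_simps)
      qed
      also have "\<dots> = real N * S b * (LINT s:{e k..b}|lborel. \<rho>1 s) + (LINT s:{e k..b}|lborel. \<rho>2 s)"
      proof -
        have "set_integrable lborel {e k..b} f" if "integrable lborel f" for f :: "real \<Rightarrow> real"
          unfolding set_integrable_def using that by (intro integrable_mult_indicator) auto
        then show ?thesis using \<rho> by (subst set_integral_add) auto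
      qed
      also have "\<dots> \<le> real N * S b * \<kappa> + C2"
      proof (intro add_mono mult_left_mono)
        have "(LINT s:{e k..b}|lborel. \<rho>1 s) \<le> (LINT s:{real n..}|lborel. \<rho>1 s)"
          using e(1)[OF k] by (intro set_integral_mono_nonneg \<rho>) (auto simp: T0_def)
        then show "(LINT s:{e k..b}|lborel. \<rho>1 s) \<le> \<kappa>" using n by simp
        show "(LINT s:{e k..b}|lborel. \<rho>2 s) \<le> C2"
          unfolding C2_def by (intro set_integral_le_integral \<rho>) auto
      qed (auto simp: S_def intro!: mult_nonneg_nonneg sum_nonneg)
      finally have inc: "norm (F \<xi> - F t) \<le> real N * S b * \<kappa> + C2" by (simp add: \<xi>_def t_def)
      \<comment> \<open>At base point t only the zeroth power of t - s survives; at base point \<xi>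
        the sum is the interpolated polynomial plus its top term.\<close>
      have "F t = y 0 t"
        unfolding F_def by (simp add: sum.atMost_shift)
      moreover have "F \<xi> = poly p (t - \<xi>) + y N \<xi> * ((t - \<xi>) ^ N / fact N)"
        unfolding F_def pp by (simp add: lessThan_Suc_atMost[symmetric])
      ultimately have "poly p (t - \<xi>) = (F \<xi> - F t) + y 0 t - y N \<xi> * ((t - \<xi>) ^ N / fact N)"
        by simp
      then have "norm (poly p (t - \<xi>)) \<le> norm (F \<xi> - F t) + norm (y 0 t) + norm (y N \<xi> * ((t - \<xi>) ^ N / fact N))"
        by (metis add_right_mono norm_triangle_ineq norm_triangle_ineq4 order_trans)
      also have "norm (y N \<xi> * ((t - \<xi>) ^ N / fact N)) \<le> C * 1"
      proof -
        have t1: "norm (t - \<xi>) \<le> 1" using e(3)[OF k] k\<sigma>[OF k] by (simp add: t_def)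
        have "norm ((t - \<xi>) ^ N / fact N) \<le> 1"
          using fact_ge_1[of N, where 'a=real] power_le_one[OF norm_ge_zero t1, of N]
          by (simp add: norm_divide norm_power divide_le_eq del: fact_ge_1)
        then show ?thesis
          unfolding norm_mult using C(2)[of b]
          by (intro mult_mono) (auto simp: \<xi>_def intro: order_trans[OF norm_ge_zero])
      qed
      finally show ?thesis
        using inc C(1)[of "e k"] by (simp add: t_def B_def algebra_simps)
    qed
    have B0: "0 \<le> B" using pb[of 0] N by (meson norm_ge_zero order_trans less_le_trans zero_less_one)
    have "norm (coeff p i) \<le> K * B" for i
    proof -
      have sep: "\<sigma> \<le> norm ((\<gamma> (e j) - \<xi>) - (\<gamma> (e k) - \<xi>))" if "j < N" "k < N" "j \<noteq> k" for j k
      proof -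
        have "1 \<le> \<bar>real j - real k\<bar>" using that by linarith
        then have "\<sigma> \<le> \<bar>real j - real k\<bar> * \<sigma>" using \<sigma> by simp
        also have "\<dots> = \<bar>norm (\<gamma> (e j) - \<xi>) - norm (\<gamma> (e k) - \<xi>)\<bar>"
          unfolding e(3)[OF that(1)] e(3)[OF that(2)] using \<sigma> by (simp add: abs_mult flip: left_diff_distrib)
        also have "\<dots> \<le> norm ((\<gamma> (e j) - \<xi>) - (\<gamma> (e k) - \<xi>))" by (rule norm_triangle_ineq3)
        finally show ?thesis .
      qed
      have "norm (\<gamma> (e k) - \<xi>) \<le> 1" if "k < N" for k
        using k\<sigma>[OF that] e(3)[OF that] by simp
      then show ?thesis
        using K[of p "\<lambda>k. \<gamma> (e k) - \<xi>" B] pb sep B0 pc by auto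
    qed
    then have "norm (y j \<xi>) \<le> fact N * (K * B)" if "j < N" for j
    proof -
      have "norm (y j \<xi>) = fact j * norm (coeff p j)" using that by (simp add: pc norm_divide)
      also have "\<dots> \<le> fact N * (K * B)"
        using \<open>\<And>i. norm (coeff p i) \<le> K * B\<close> that by (intro mult_mono) (auto intro: fact_mono)
      finally show ?thesis .
    qed
    then have "S b \<le> (\<Sum>j<N. fact N * (K * B))"
      unfolding S_def \<xi>_def by (intro sum_mono) auto
    also have "\<dots> = A + Q * N * \<kappa> * S b"
      by (simp add: A_def B_def Q_def algebra_simps)
    also have "\<dots> \<le> A + 1 / 2 * S b"
      using Q\<kappa> by (intro add_left_mono mult_right_mono) (auto simp: S_def sum_nonneg)
    finally show ?thesis by simp
  qed
  have "S \<tau> \<le> max M0 (2 * A)" if "0 \<le> \<tau>" for \<tau>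
  proof (cases "\<tau> \<le> T")
    case True
    then show ?thesis using M0 that by (simp add: max.coboundedI1)
  next
    case False
    \<comment> \<open>Choosing the point where \<open>S\<close> is largest on this interval supplies
      the maximality that \<open>main\<close> assumes; if it lies before \<open>T\<close>,
      compactness already bounds \<open>S\<close> there.\<close>
    then have "\<exists>x\<in>{T0..\<tau>}. \<forall>s\<in>{T0..\<tau>}. S s \<le> S x"
      by (intro continuous_attains_sup cS) (auto simp: T_def)
    then obtain b where b: "T0 \<le> b" "b \<le> \<tau>" "\<And>s. T0 \<le> s \<Longrightarrow> s \<le> \<tau> \<Longrightarrow> S s \<le> S b" by auto
    have "S \<tau> \<le> S b" using b False by (simp add: T_def)
    moreover have "S b \<le> max M0 (2 * A)"
    proof (cases "b \<le> T")
      case True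
      then show ?thesis using M0[of b] b(1) by (simp add: T0_def max.coboundedI1)
    next
      case False
      then have "S b \<le> 2 * A" using b by (intro main) auto
      then show ?thesis by simp
    qed
    ultimately show ?thesis by simp
  qed
  then show ?thesis using S by (meson order_trans)
qed

section \<open>Neumann series\<close>

text \<open>Summing the recursion reproduces half of the partial sum of \<open>N\<close> on the
  right; absorbing it bounds all partial sums by twice \<open>N 0 + suminf b\<close>.\<close>

lemma summable_contraction:
  fixes N b :: "nat \<Rightarrow> real"
  assumes N: "\<And>m. 0 \<le> N m" and b: "summable b" "\<And>m. 0 \<le> b m"
    and le: "\<And>m. N (Suc m) \<le> b (Suc m) + N m / 2"
  shows "summable N"
proof (rule summableI_nonneg_bounded)
  fix n
  have "(\<Sum>i<n. N i) \<le> N 0 + (\<Sum>i<n. b i) + (\<Sum>i<n. N i) / 2"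
  proof (induction n)
    case (Suc n)
    show ?case
    proof (cases n)
      case 0
      then show ?thesis using N[of 0] b(2)[of 0] by simp
    next
      case (Suc k)
      have "(\<Sum>i<Suc n. N i) = N 0 + (\<Sum>i<n. N (Suc i))"
        by (rule sum.lessThan_Suc_shift)
      also have "\<dots> \<le> N 0 + (\<Sum>i<n. b (Suc i) + N i / 2)"
        by (intro add_left_mono sum_mono le)
      also have "\<dots> = N 0 + (\<Sum>i<n. b (Suc i)) + (\<Sum>i<n. N i) / 2"
        by (simp add: sum.distrib sum_divide_distrib)
      also have "(\<Sum>i<n. b (Suc i)) \<le> (\<Sum>i<Suc n. b i)"
        using b(2)[of 0] by (simp add: sum.lessThan_Suc_shift del: sum.lessThan_Suc)
      also have "(\<Sum>i<n. N i) / 2 \<le> (\<Sum>i<Suc n. N i) / 2"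
        using N[of n] by simp
      finally show ?thesis by simp
    qed
  qed (use N in simp)
  moreover have "(\<Sum>i<n. b i) \<le> suminf b"
    using b by (intro sum_le_suminf) auto
  moreover have "x \<le> 2 * (a + t)" if "x \<le> a + s + x / 2" "s \<le> t" for x a s t :: real
    using that by argo
  ultimately show "(\<Sum>i<n. N i) \<le> 2 * (N 0 + suminf b)" by blast
qed (rule N)

text \<open>A Gronwall-type argument on a small disc. At a maximum point of |f| + |f'| the mean
  value inequality compares with \<open>a\<close>, the increments costing a fraction of the maxima
  \<open>N (Suc m)\<close> and \<open>N m\<close>; so the maxima obey a recursion with ratio 1/2.
  The radius depends neither on \<open>m\<close> nor on \<open>a\<close>, and \<open>a\<close> is
  free in the disc, which lets summability travel in every direction.\<close>

lemma neumann_locally_summable: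
  fixes f :: "nat \<Rightarrow> complex \<Rightarrow> complex"
  assumes D: "open D" and \<psi>: "\<psi> holomorphic_on D" and f: "\<And>m. f m holomorphic_on D"
    and rec: "\<And>m z. z \<in> D \<Longrightarrow> deriv (deriv (f (Suc m))) z = c * f (Suc m) z + \<psi> z * f m z"
    and z: "z \<in> D"
  obtains r where "r > 0" "cball z r \<subseteq> D"
    "\<And>a. a \<in> cball z r \<Longrightarrow> summable (\<lambda>m. norm (f m a) + norm (deriv (f m) a)) \<Longrightarrow>
      \<exists>N. summable N \<and> (\<forall>m. \<forall>w\<in>cball z r. norm (f m w) + norm (deriv (f m) w) \<le> N m)"
proof -
  define s where "s m w = norm (f m w) + norm (deriv (f m) w)" for m w
  obtain r0 where r0: "r0 > 0" "cball z r0 \<subseteq> D"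
    using D z open_contains_cball by blast
  have "compact (\<psi> ` cball z r0)"
    using \<psi> r0 by (intro compact_continuous_image) (auto intro: holomorphic_on_imp_continuous_on holomorphic_on_subset)
  then have "bounded (\<psi> ` cball z r0)" by (rule compact_imp_bounded)
  then obtain M0 where M0: "\<And>w. w \<in> cball z r0 \<Longrightarrow> norm (\<psi> w) \<le> M0"
    unfolding bounded_iff by blast
  define M where "M = 1 + norm c + M0"
  have "M0 \<ge> 0" using M0[of z] r0 by (force intro: order_trans[OF norm_ge_zero])
  then have M: "M \<ge> 1" "M \<ge> norm c" "M \<ge> M0" by (auto simp: M_def)
  \<comment> \<open>Points of the disc are at most 2r apart and \<open>M\<close> bounds 1, |c| and
    |\<psi>|, so this radius makes each increment at most a quarter of the maxima involved.\<close>
  define r where "r = min r0 (1 / (8 * M))"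
  have r: "r > 0" "cball z r \<subseteq> cball z r0" using r0 M by (auto simp: r_def)
  have rM: "2 * r * M \<le> 1 / 4"
  proof -
    have "r \<le> 1 / (8 * M)" by (simp add: r_def)
    then have "r * (8 * M) \<le> 1" using M by (simp add: pos_le_divide_eq)
    then show ?thesis by simp
  qed
  then have r4: "2 * r \<le> 1 / 4"
    using mult_left_mono[OF M(1), of "2 * r"] r by linarith
  have d1: "(f m has_field_derivative deriv (f m) w) (at w)" if "w \<in> D" for m w
    using f D that by (rule holomorphic_derivI)
  have d2: "(deriv (f m) has_field_derivative deriv (deriv (f m)) w) (at w)" if "w \<in> D" for m w
    using holomorphic_deriv[OF f D] D that by (rule holomorphic_derivI)
  have cs: "continuous_on (cball z r) (s m)" for m
    unfolding s_def[abs_def] using r r0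
    by (intro continuous_intros holomorphic_on_imp_continuous_on[THEN continuous_on_subset, where s=D] f holomorphic_deriv D) auto
  have "\<exists>w\<in>cball z r. \<forall>v\<in>cball z r. s m v \<le> s m w" for m
    using r by (intro continuous_attains_sup cs) auto
  then obtain p where p: "\<And>m. p m \<in> cball z r" "\<And>m v. v \<in> cball z r \<Longrightarrow> s m v \<le> s m (p m)"
    by metis
  define N where "N m = s m (p m)" for m
  have "\<exists>N. summable N \<and> (\<forall>m. \<forall>w\<in>cball z r. s m w \<le> N m)"
    if a: "a \<in> cball z r" and sa: "summable (\<lambda>m. s m a)" for a
  proof -
    have N: "N (Suc m) \<le> 2 * s (Suc m) a + N m / 2" for m
    proof -
      define w where "w = p (Suc m)"
      have w: "w \<in> cball z r" using p by (simp add: w_def)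
      have wa: "norm (w - a) \<le> 2 * r"
        using w a dist_triangle2[of w a z] by (simp add: dist_norm norm_minus_commute)
      have Nn: "0 \<le> N k" for k by (simp add: N_def s_def)
      have fN: "norm (f k v) \<le> N k" "norm (deriv (f k) v) \<le> N k" if "v \<in> cball z r" for k v
        using p(2)[OF that, of k] norm_ge_zero[of "f k v"] norm_ge_zero[of "deriv (f k) v"]
        unfolding s_def N_def by linarith+
      have inD: "v \<in> D" if "v \<in> cball z r" for v using that r r0 by blast
      have "norm (f (Suc m) w - f (Suc m) a) \<le> N (Suc m) * norm (w - a)"
        by (rule field_differentiable_bound[OF convex_cball _ _ w a])
           (use d1 inD fN in \<open>auto intro: has_field_derivative_at_within\<close>)
      also have "\<dots> \<le> N (Suc m) * (1 / 4)"
        using wa r4 Nn by (intro mult_left_mono) auto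
      finally have 1: "norm (f (Suc m) w) \<le> norm (f (Suc m) a) + N (Suc m) / 4"
        using norm_triangle_sub[of "f (Suc m) w" "f (Suc m) a"] by simp
      have "norm (deriv (f (Suc m)) w - deriv (f (Suc m)) a) \<le> (M * N (Suc m) + M * N m) * norm (w - a)"
      proof (rule field_differentiable_bound[OF convex_cball _ _ w a])
        fix v assume v: "v \<in> cball z r"
        show "(deriv (f (Suc m)) has_field_derivative c * f (Suc m) v + \<psi> v * f m v) (at v within cball z r)"
          using d2[OF inD[OF v]] rec[OF inD[OF v]] by (metis has_field_derivative_at_within)
        have "norm (c * f (Suc m) v) \<le> M * N (Suc m)"
          unfolding norm_mult using M fN[OF v] by (intro mult_mono) auto
        moreover have "norm (\<psi> v * f m v) \<le> M * N m"
          unfolding norm_mult using M M0[of v] r v fN[OF v] by (intro mult_mono) auto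
        ultimately show "norm (c * f (Suc m) v + \<psi> v * f m v) \<le> M * N (Suc m) + M * N m"
          by (meson add_mono norm_triangle_ineq order_trans)
      qed
      also have "\<dots> \<le> (M * N (Suc m) + M * N m) * (2 * r)"
        using wa M Nn by (intro mult_left_mono) auto
      also have "\<dots> = (2 * r * M) * (N (Suc m) + N m)"
        by (simp add: algebra_simps)
      also have "\<dots> \<le> 1 / 4 * (N (Suc m) + N m)"
        using rM Nn by (intro mult_right_mono) auto
      finally have 2: "norm (deriv (f (Suc m)) w) \<le> norm (deriv (f (Suc m)) a) + (N (Suc m) + N m) / 4"
        using norm_triangle_sub[of "deriv (f (Suc m)) w" "deriv (f (Suc m)) a"] by linarith
      have "N (Suc m) = norm (f (Suc m) w) + norm (deriv (f (Suc m)) w)"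
        by (simp add: N_def s_def w_def)
      then show ?thesis using 1 2 unfolding s_def by argo
    qed
    have "summable N"
    proof (rule summable_contraction[where b="\<lambda>m. 2 * s m a"])
      show "summable (\<lambda>m. 2 * s m a)" using sa by (rule summable_mult)
    qed (use N in \<open>auto simp: s_def N_def\<close>)
    then show ?thesis using p(2) by (auto simp: N_def)
  qed
  then show thesis
    using that[of r] r r0 unfolding s_def by auto
qed

lemma neumann_series:
  fixes f :: "nat \<Rightarrow> complex \<Rightarrow> complex"
  assumes D: "open D" "connected D" and \<psi>: "\<psi> holomorphic_on D" and f: "\<And>m. f m holomorphic_on D"
    and rec: "\<And>m z. z \<in> D \<Longrightarrow> deriv (deriv (f (Suc m))) z = c * f (Suc m) z + \<psi> z * f m z"
    and a: "a \<in> D" "summable (\<lambda>m. norm (f m a) + norm (deriv (f m) a))"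
  obtains F where "F holomorphic_on D" "\<And>z. z \<in> D \<Longrightarrow> (\<lambda>m. f m z) sums F z"
    "\<And>z. z \<in> D \<Longrightarrow> deriv (deriv F) z = deriv (deriv (f 0)) z + c * (F z - f 0 z) + \<psi> z * F z"
proof -
  define s where "s m w = norm (f m w) + norm (deriv (f m) w)" for m w
  define F where "F w = (\<Sum>m. f m w)" for w
  define good where "good S \<longleftrightarrow> (\<forall>b\<in>S. summable (\<lambda>m. s m b) \<longrightarrow>
      (\<exists>N. summable N \<and> (\<forall>m. \<forall>w\<in>S. s m w \<le> N m)))" for S
  have loc: "\<exists>r>0. cball z r \<subseteq> D \<and> good (cball z r)" if z: "z \<in> D" for z
    by (rule neumann_locally_summable[where f=f and c=c, OF D(1) \<psi> f rec z])
      (auto simp: s_def good_def)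
  have s0: "0 \<le> s m w" for m w by (simp add: s_def)
  \<comment> \<open>Near each point of \<open>D\<close>, summability passes from any point of a
    small ball to any other; connectedness then carries it from \<open>a\<close> to all of
    \<open>D\<close>.\<close>
  have sum: "summable (\<lambda>m. s m z)" if zD: "z \<in> D" for z
  proof (rule connected_induction_simple[OF D(2), where P="\<lambda>z. summable (\<lambda>m. s m z)" and a=a and b=z])
    fix x assume x: "x \<in> D"
    obtain r where r: "r > 0" "cball x r \<subseteq> D"
      and N: "good (cball x r)"
      using loc[OF x] by blast
    have "summable (\<lambda>m. s m w)" if bw: "b \<in> ball x r" "w \<in> ball x r" "summable (\<lambda>m. s m b)" for b w
    proof -
      have "b \<in> cball x r" "w \<in> cball x r" using bw by auto
      then obtain N' where N': "summable N'" "\<And>m. s m w \<le> N' m"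
        using bspec[OF N[unfolded good_def], THEN mp, OF _ bw(3)] by meson
      show ?thesis
        by (rule summable_comparison_test'[OF N'(1), of 0])
           (use N'(2) s0 in auto)
    qed
    then have "\<forall>v\<in>ball x r. \<forall>w\<in>ball x r. summable (\<lambda>m. s m v) \<longrightarrow> summable (\<lambda>m. s m w)"
      by blast
    moreover have "openin (top_of_set D) (ball x r)"
      using r ball_subset_cball by (intro open_subset) blast+
    ultimately show "\<exists>T. openin (top_of_set D) T \<and> x \<in> T \<and>
        (\<forall>x\<in>T. \<forall>y\<in>T. summable (\<lambda>m. s m x) \<longrightarrow> summable (\<lambda>m. s m y))"
      using r(1) by (intro exI[of _ "ball x r"] conjI) (assumption | simp)+
  qed (use a zD in \<open>auto simp: s_def\<close>)
  have ul: "\<exists>r>0. cball z r \<subseteq> D \<and>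
      uniform_limit (cball z r) (\<lambda>n w. \<Sum>m<n. f m w) F sequentially" if z: "z \<in> D" for z
  proof -
    obtain r where r: "r > 0" "cball z r \<subseteq> D"
      and N0: "good (cball z r)"
      using loc[OF z] by blast
    have "z \<in> cball z r" using r by simp
    then obtain N where N: "summable N" "\<And>m w. w \<in> cball z r \<Longrightarrow> s m w \<le> N m"
      using bspec[OF N0[unfolded good_def], THEN mp, OF _ sum[OF z]] by meson
    have "uniform_limit (cball z r) (\<lambda>n w. \<Sum>m<n. f m w) F sequentially"
      unfolding F_def[abs_def]
    proof (rule Weierstrass_m_test[OF _ N(1)])
      fix m w assume "w \<in> cball z r"
      from N(2)[OF this, of m] show "norm (f m w) \<le> N m"
        unfolding s_def using norm_ge_zero[of "deriv (f m) w"] by linarith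
    qed
    with r show ?thesis by blast
  qed
  have Fh: "F holomorphic_on D"
    by (rule holomorphic_uniform_sequence[OF D(1), where f="\<lambda>n w. \<Sum>m<n. f m w"])
       (use ul f in \<open>auto intro!: holomorphic_intros\<close>)
  have sums: "(\<lambda>m. f m z) sums F z" if "z \<in> D" for z
  proof -
    have "summable (\<lambda>m. f m z)"
      by (rule summable_norm_cancel, rule summable_comparison_test'[OF sum[OF that], of 0])
         (simp add: s_def)
    then show ?thesis unfolding F_def by (rule summable_sums)
  qed
  have "deriv (deriv F) z = deriv (deriv (f 0)) z + c * (F z - f 0 z) + \<psi> z * F z" if z: "z \<in> D" for z
  proof -
    obtain r where r: "r > 0" "cball z r \<subseteq> D"
      "uniform_limit (cball z r) (\<lambda>n w. \<Sum>m<n. f m w) F sequentially"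
      using ul[OF z] by blast
    have 1: "(\<lambda>n. (deriv ^^ 2) (\<lambda>w. \<Sum>m<n. f m w) z) \<longlonglongrightarrow> (deriv ^^ 2) F z"
    proof (rule higher_deriv_complex_uniform_limit)
      show "uniform_limit (ball z r) (\<lambda>n w. \<Sum>m<n. f m w) F sequentially"
        using r(3) ball_subset_cball by (rule uniform_limit_on_subset)
      have "f m holomorphic_on ball z r" for m
        using f r(2) ball_subset_cball by (meson holomorphic_on_subset order_trans)
      then show "\<forall>\<^sub>F n in sequentially. (\<lambda>w. \<Sum>m<n. f m w) holomorphic_on ball z r"
        by (intro always_eventually allI holomorphic_intros)
    qed (use r in auto)
    have 2: "deriv (deriv (\<lambda>w. \<Sum>m<n. f m w)) z = (\<Sum>m<n. deriv (deriv (f m)) z)" for n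
    proof -
      have "(deriv (\<lambda>w. \<Sum>m<n. f m w) has_field_derivative (\<Sum>m<n. deriv (deriv (f m)) z)) (at z)"
      proof (rule has_field_derivative_deriv[OF D(1) _ _ z])
        show "((\<lambda>w. \<Sum>m<n. f m w) has_field_derivative (\<Sum>m<n. deriv (f m) w)) (at w)" if "w \<in> D" for w
          using holomorphic_derivI[OF f D(1) that] by (intro DERIV_sum)
        show "((\<lambda>w. \<Sum>m<n. deriv (f m) w) has_field_derivative (\<Sum>m<n. deriv (deriv (f m)) z)) (at z)"
          using holomorphic_derivI[OF holomorphic_deriv[OF f D(1)] D(1) z] by (intro DERIV_sum)
      qed
      then show ?thesis by (rule DERIV_imp_deriv)
    qed
    have "(\<lambda>n. \<Sum>m<n. deriv (deriv (f m)) z) \<longlonglongrightarrow> deriv (deriv F) z"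
      using 1 unfolding 2[symmetric] by (simp add: numeral_2_eq_2)
    \<comment> \<open>The shift matters: term m + 1 is driven by term m, so \<open>Suc n\<close>
      second derivatives meet \<open>n\<close> terms of \<psi> f, and in the limit \<psi> multiplies
      the full sum \<open>F\<close>, not \<open>F - f 0\<close>.\<close>
    then have "(\<lambda>n. \<Sum>m<Suc n. deriv (deriv (f m)) z) \<longlonglongrightarrow> deriv (deriv F) z"
      by (rule LIMSEQ_Suc)
    moreover have "(\<Sum>m<Suc n. deriv (deriv (f m)) z) =
       deriv (deriv (f 0)) z + c * ((\<Sum>m<Suc n. f m z) - f 0 z) + \<psi> z * (\<Sum>m<n. f m z)" for n
      unfolding sum.lessThan_Suc_shift rec[OF z]
      by (simp add: sum.distrib sum_distrib_left)
    moreover have "(\<lambda>n. deriv (deriv (f 0)) z + c * ((\<Sum>m<Suc n. f m z) - f 0 z) + \<psi> z * (\<Sum>m<n. f m z))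
        \<longlonglongrightarrow> deriv (deriv (f 0)) z + c * (F z - f 0 z) + \<psi> z * F z"
      using sums[OF z] unfolding sums_def
      by (intro tendsto_intros LIMSEQ_Suc[where f="\<lambda>n. \<Sum>m<n. f m z"]) auto
    ultimately show ?thesis
      by (metis (no_types, lifting) LIMSEQ_unique ext)
  qed
  with Fh sums show thesis using that by blast
qed

section \<open>Simply connected neighbourhoods of the path\<close>

text \<open>Every vertical line meets the path in a segment, so the points of \<open>\<Delta>\<close> that see the path
  vertically form an open set with vertically convex sections; from any point outside one of
  the two vertical rays avoids it, and winding numbers vanish.\<close>

lemma vertical_neighbourhood:
  fixes \<gamma> :: "real \<Rightarrow> complex"
  assumes \<Delta>: "open \<Delta>" "range \<gamma> \<subseteq> \<Delta>" and c: "continuous_on UNIV \<gamma>"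
    and mono: "mono (\<lambda>\<tau>. Re (\<gamma> \<tau>))"
    and top: "filterlim (\<lambda>\<tau>. Re (\<gamma> \<tau>)) at_top at_top"
    and bot: "filterlim (\<lambda>\<tau>. Re (\<gamma> \<tau>)) at_bot at_bot"
  obtains D where "open D" "simply_connected D" "D \<subseteq> \<Delta>" "range \<gamma> \<subseteq> D"
proof -
  \<comment> \<open>Quantifying over all path points on the vertical line through \<open>z\<close>
    makes failure an existential statement over compact data, from which openness will
    follow.\<close>
  define D where "D = {z. \<forall>\<tau>. Re (\<gamma> \<tau>) = Re z \<longrightarrow>
    (\<forall>y\<in>closed_segment (Im z) (Im (\<gamma> \<tau>)). Complex (Re z) y \<in> \<Delta>)}"
  have cRe: "continuous_on A (\<lambda>\<tau>. Re (\<gamma> \<tau>))" and cIm: "continuous_on A (\<lambda>\<tau>. Im (\<gamma> \<tau>))" for A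
    using c by (auto intro!: continuous_intros intro: continuous_on_subset)
  have upper: "\<exists>b. \<forall>\<tau>. Re (\<gamma> \<tau>) \<le> x \<longrightarrow> \<tau> < b" for x
  proof -
    have "\<forall>\<^sub>F \<tau> in at_top. Re (\<gamma> \<tau>) > x" using top unfolding filterlim_at_top_dense by blast
    then obtain b where "\<And>\<tau>. \<tau> \<ge> b \<Longrightarrow> Re (\<gamma> \<tau>) > x" by (auto simp: eventually_at_top_linorder)
    then show ?thesis by (meson not_le)
  qed
  have lower: "\<exists>b. \<forall>\<tau>. x \<le> Re (\<gamma> \<tau>) \<longrightarrow> b < \<tau>" for x
  proof -
    have "\<forall>\<^sub>F \<tau> in at_bot. Re (\<gamma> \<tau>) < x" using bot unfolding filterlim_at_bot_dense by blast
    then obtain b where "\<And>\<tau>. \<tau> \<le> b \<Longrightarrow> Re (\<gamma> \<tau>) < x" by (auto simp: eventually_at_bot_linorder)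
    then show ?thesis by (meson not_le)
  qed
  have hit: "\<exists>\<tau>. Re (\<gamma> \<tau>) = x" for x
  proof -
    obtain b where b: "\<And>\<tau>. Re (\<gamma> \<tau>) \<le> x \<Longrightarrow> \<tau> < b" using upper by blast
    obtain a where a: "\<And>\<tau>. x \<le> Re (\<gamma> \<tau>) \<Longrightarrow> a < \<tau>" using lower by blast
    have "Re (\<gamma> a) \<le> x" "x \<le> Re (\<gamma> b)" using a[of a] b[of b] by (metis order.irrefl linear)+
    then show ?thesis
      using IVT'[of "\<lambda>\<tau>. Re (\<gamma> \<tau>)" a x b] b[of a] cRe by auto
  qed
  \<comment> \<open>Between two parameters with equal Re \<gamma> monotonicity keeps Re \<gamma>
    constant, and continuity of Im \<gamma> then fills the vertical segment between the two
    points.\<close>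
  have fibre: "\<exists>r. \<gamma> r = Complex (Re (\<gamma> s)) y"
    if eq: "Re (\<gamma> \<tau>) = Re (\<gamma> s)" and y: "y \<in> closed_segment (Im (\<gamma> s)) (Im (\<gamma> \<tau>))" for s \<tau> y
  proof -
    have "connected ((\<lambda>r. Im (\<gamma> r)) ` closed_segment s \<tau>)"
      by (intro connected_continuous_image cIm connected_segment)
    then have "convex ((\<lambda>r. Im (\<gamma> r)) ` closed_segment s \<tau>)"
      by (metis is_interval_connected_1 is_interval_convex_1)
    then have "closed_segment (Im (\<gamma> s)) (Im (\<gamma> \<tau>)) \<subseteq> (\<lambda>r. Im (\<gamma> r)) ` closed_segment s \<tau>"
      by (simp add: closed_segment_subset)
    then obtain r where r: "r \<in> closed_segment s \<tau>" "Im (\<gamma> r) = y" using y by blast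
    have "Re (\<gamma> r) = Re (\<gamma> s)"
      using r(1) eq monoD[OF mono, of s r] monoD[OF mono, of r \<tau>] monoD[OF mono, of \<tau> r] monoD[OF mono, of r s]
      by (auto simp: closed_segment_eq_real_ivl split: if_splits)
    with r show ?thesis by (metis complex_surj)
  qed
  have \<gamma>D: "\<gamma> s \<in> D" for s
    unfolding D_def mem_Collect_eq
  proof (intro allI impI ballI)
    fix \<tau> y assume "Re (\<gamma> \<tau>) = Re (\<gamma> s)" "y \<in> closed_segment (Im (\<gamma> s)) (Im (\<gamma> \<tau>))"
    then show "Complex (Re (\<gamma> s)) y \<in> \<Delta>"
      using fibre[of \<tau> s y] \<Delta>(2) by (metis rangeI subsetD)
  qed
  have D\<Delta>: "D \<subseteq> \<Delta>"
  proof
    fix z assume z: "z \<in> D"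
    obtain \<tau> where "Re (\<gamma> \<tau>) = Re z" using hit by blast
    with z have "Complex (Re z) (Im z) \<in> \<Delta>" unfolding D_def by blast
    then show "z \<in> \<Delta>" by simp
  qed
  have between: "Complex x y \<in> D" if "Complex x y1 \<in> D" "Complex x y2 \<in> D" "y1 \<le> y" "y \<le> y2" for x y y1 y2
    using that unfolding D_def by (fastforce simp: closed_segment_eq_real_ivl split: if_splits)
  \<comment> \<open>A failure at \<open>z n\<close> is recorded by a path parameter and a convex
    weight. Both stay in compact sets, the parameters because Re \<gamma> leaves every bounded
    interval at both ends; a convergent subsequence yields a failure at the limit.\<close>
  have "closed (- D)"
    unfolding closed_sequential_limits
  proof (intro allI impI, elim conjE)
    fix z l assume zD: "\<forall>n. z n \<in> - D" and zl: "z \<longlonglongrightarrow> l"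
    have "\<exists>\<tau> y. Re (\<gamma> \<tau>) = Re (z n) \<and> y \<in> closed_segment (Im (z n)) (Im (\<gamma> \<tau>)) \<and>
        Complex (Re (z n)) y \<notin> \<Delta>" for n
      using zD unfolding D_def by blast
    then obtain t y where t: "\<And>n. Re (\<gamma> (t n)) = Re (z n)"
      and y: "\<And>n. y n \<in> closed_segment (Im (z n)) (Im (\<gamma> (t n)))"
      and out: "\<And>n. Complex (Re (z n)) (y n) \<notin> \<Delta>" by metis
    have "\<exists>k. 0 \<le> k \<and> k \<le> 1 \<and> y n = (1 - k) * Im (z n) + k * Im (\<gamma> (t n))" for n
      using y[of n] by (auto simp: closed_segment_def)
    then obtain \<Lambda> where \<Lambda>: "\<And>n. 0 \<le> \<Lambda> n" "\<And>n. \<Lambda> n \<le> 1"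
      "\<And>n. y n = (1 - \<Lambda> n) * Im (z n) + \<Lambda> n * Im (\<gamma> (t n))" by metis
    obtain R where R: "\<And>n. norm (z n) \<le> R"
      using convergent_imp_Bseq[OF convergentI[OF zl]] by (auto simp: Bseq_def)
    have Rez: "- R \<le> Re (z n)" "Re (z n) \<le> R" for n
      using R[of n] abs_Re_le_cmod[of "z n"] by linarith+
    obtain b where b: "\<And>\<tau>. Re (\<gamma> \<tau>) \<le> R \<Longrightarrow> \<tau> < b" using upper by blast
    obtain a where a: "\<And>\<tau>. - R \<le> Re (\<gamma> \<tau>) \<Longrightarrow> a < \<tau>" using lower by blast
    have tab: "t n \<in> {a..b}" for n using a[of "t n"] b[of "t n"] t[of n] Rez[of n] by auto
    have "seq_compact ({a..b} \<times> {0..1::real})"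
      by (intro compact_imp_seq_compact compact_Times) auto
    then obtain q \<phi> where q: "q \<in> {a..b} \<times> {0..1}" and \<phi>: "strict_mono \<phi>"
      and lim: "((\<lambda>n. (t n, \<Lambda> n)) \<circ> \<phi>) \<longlonglongrightarrow> q"
      by (rule seq_compactE[where f="\<lambda>n. (t n, \<Lambda> n)"]) (use tab \<Lambda> in auto)
    obtain \<tau> \<mu> where q': "q = (\<tau>, \<mu>)" by (cases q)
    have lt: "(\<lambda>n. t (\<phi> n)) \<longlonglongrightarrow> \<tau>" and l\<Lambda>: "(\<lambda>n. \<Lambda> (\<phi> n)) \<longlonglongrightarrow> \<mu>"
      using tendsto_fst[OF lim] tendsto_snd[OF lim] by (auto simp: q' o_def)
    have lz: "(\<lambda>n. z (\<phi> n)) \<longlonglongrightarrow> l"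
      using LIMSEQ_subseq_LIMSEQ[OF zl \<phi>] by (simp add: o_def)
    have lg: "(\<lambda>n. \<gamma> (t (\<phi> n))) \<longlonglongrightarrow> \<gamma> \<tau>"
      using continuous_on_tendsto_compose[OF c lt] by simp
    have "(\<lambda>n. Re (\<gamma> (t (\<phi> n)))) \<longlonglongrightarrow> Re l"
      unfolding t by (intro tendsto_intros lz)
    then have Re: "Re (\<gamma> \<tau>) = Re l"
      using tendsto_Re[OF lg] LIMSEQ_unique by blast
    define y0 where "y0 = (1 - \<mu>) * Im l + \<mu> * Im (\<gamma> \<tau>)"
    have "(\<lambda>n. Complex (Re (z (\<phi> n))) (y (\<phi> n))) \<longlonglongrightarrow> Complex (Re l) y0"
      unfolding y0_def \<Lambda>(3) by (intro tendsto_intros lz l\<Lambda> lg)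
    moreover have "closed (- \<Delta>)" using \<Delta>(1) by (simp add: closed_Compl)
    ultimately have "Complex (Re l) y0 \<in> - \<Delta>"
      using out by (metis (no_types, lifting) ComplI closed_sequentially)
    moreover have "y0 \<in> closed_segment (Im l) (Im (\<gamma> \<tau>))"
      using q by (auto simp: q' y0_def closed_segment_def)
    ultimately show "l \<in> - D" using Re by (auto simp: D_def)
  qed
  then have oD: "open D" by (simp add: open_closed)
  have conn: "connected D"
    unfolding connected_iff_connected_component
  proof (intro ballI)
    have r: "connected_component D (\<gamma> s) (\<gamma> t)" for s t
      unfolding connected_component_def
      using connected_continuous_image[OF c connected_UNIV] \<gamma>D by (intro exI[of _ "range \<gamma>"]) auto
    have v: "\<exists>\<tau>. connected_component D z (\<gamma> \<tau>)" if z: "z \<in> D" for z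
    proof -
      obtain \<tau> where \<tau>: "Re (\<gamma> \<tau>) = Re z" using hit by blast
      let ?S = "Complex (Re z) ` closed_segment (Im z) (Im (\<gamma> \<tau>))"
      have "connected ?S"
        by (intro connected_continuous_image connected_segment)
           (auto simp: Complex_eq intro!: continuous_intros)
      moreover have "?S \<subseteq> D"
        using between[of "Re z" "Im z" "Im (\<gamma> \<tau>)"] between[of "Re z" "Im (\<gamma> \<tau>)" "Im z"] z \<gamma>D[of \<tau>]
        by (auto simp: closed_segment_eq_real_ivl \<tau>[symmetric] complex_surj split: if_splits)
           (auto simp: \<tau>)
      moreover have "z \<in> ?S" by (auto intro!: image_eqI[of _ _ "Im z"])
      moreover have "\<gamma> \<tau> \<in> ?S" using \<tau> by (auto intro!: image_eqI[of _ _ "Im (\<gamma> \<tau>)"] simp: complex_eq_iff)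
      ultimately show ?thesis unfolding connected_component_def by blast
    qed
    fix x y assume "x \<in> D" "y \<in> D"
    then show "connected_component D x y"
      using v r by (meson connected_component_sym connected_component_trans)
  qed
  have wn: "winding_number p z = 0"
    if p: "path p" "path_image p \<subseteq> D" "pathfinish p = pathstart p" and z: "z \<notin> D" for p z
  proof -
    obtain \<sigma> :: real where \<sigma>: "\<sigma> = 1 \<or> \<sigma> = - 1" and ray: "\<And>t. t \<ge> 0 \<Longrightarrow> Complex (Re z) (Im z + \<sigma> * t) \<notin> D"
    proof (cases "\<forall>t\<ge>0. Complex (Re z) (Im z + 1 * t) \<notin> D")
      case True
      then show thesis using that[of 1] by blast
    next
      case False
      then obtain t where t: "t \<ge> 0" "Complex (Re z) (Im z + t) \<in> D" by auto
      have "Complex (Re z) (Im z + (- 1) * s) \<notin> D" if "s \<ge> 0" for s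
        using between[of "Re z" "Im z - s" "Im z + t" "Im z"] t that z by auto
      then show thesis using that[of "- 1"] by blast
    qed
    define L where "L = (\<lambda>t. Complex (Re z) (Im z + \<sigma> * t)) ` {0..}"
    have "connected L"
      unfolding L_def
      by (intro connected_continuous_image) (auto simp: Complex_eq intro!: continuous_intros)
    moreover have "L \<subseteq> - path_image p" using ray p(2) by (auto simp: L_def)
    moreover have zL: "z \<in> L" by (auto simp: L_def intro!: image_eqI[of _ _ 0])
    ultimately have sub: "L \<subseteq> connected_component_set (- path_image p) z"
      by (metis connected_component_maximal)
    have "\<not> bounded L"
    proof
      assume "bounded L"
      then obtain B where B: "\<And>w. w \<in> L \<Longrightarrow> norm w \<le> B" by (auto simp: bounded_iff)
      define w where "w = Complex (Re z) (Im z + \<sigma> * (\<bar>B\<bar> + \<bar>Im z\<bar> + 1))"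
      have "w \<in> L" by (auto simp: w_def L_def)
      then have "\<bar>Im w\<bar> \<le> B" using B abs_Im_le_cmod[of w] by force
      then show False using \<sigma> by (auto simp: w_def)
    qed
    then have "z \<in> outside (path_image p)"
      using sub bounded_subset by (auto simp: outside)
    then show ?thesis by (rule winding_number_zero_in_outside[OF p(1,3)])
  qed
  have "simply_connected D"
    unfolding simply_connected_eq_winding_number_zero[OF oD] using conn wn by blast
  with oD D\<Delta> \<gamma>D show thesis using that by blast
qed

text \<open>Multiplication by u carries the level lines of Re (u z) to vertical lines. The vertical
  neighbourhood is built in the image and brought back by this homeomorphism.\<close>

lemma branch_domain_exists:
  fixes \<gamma> :: "real \<Rightarrow> complex"
  assumes \<Delta>: "open \<Delta>" "range \<gamma> \<subseteq> \<Delta>" and c: "continuous_on UNIV \<gamma>" and u: "u \<noteq> 0"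
    and mono: "mono (\<lambda>\<tau>. Re (u * \<gamma> \<tau>))"
    and top: "filterlim (\<lambda>\<tau>. Re (u * \<gamma> \<tau>)) at_top at_top"
    and bot: "filterlim (\<lambda>\<tau>. Re (u * \<gamma> \<tau>)) at_bot at_bot"
  shows "\<exists>D. branch_domain \<Delta> D \<and> range \<gamma> \<subseteq> D"
proof -
  have eq: "(\<lambda>z. u * z) ` A = (\<lambda>z. z / u) -` A" "(\<lambda>z. z / u) ` A = (\<lambda>z. u * z) -` A" for A
    using u by (auto intro: rev_image_eqI)
  have op: "open ((\<lambda>z. z / u) -` A)" "open ((\<lambda>z. u * z) -` A)" if "open A" for A
    using that u by (auto intro!: open_vimage continuous_intros)
  obtain D' where D': "open D'" "simply_connected D'" "D' \<subseteq> (\<lambda>z. u * z) ` \<Delta>" "range (\<lambda>\<tau>. u * \<gamma> \<tau>) \<subseteq> D'"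
  proof (rule vertical_neighbourhood[of "(\<lambda>z. u * z) ` \<Delta>" "\<lambda>\<tau>. u * \<gamma> \<tau>"])
    show "open ((\<lambda>z. u * z) ` \<Delta>)" unfolding eq using \<Delta>(1) by (rule op)
    show "continuous_on UNIV (\<lambda>\<tau>. u * \<gamma> \<tau>)" by (intro continuous_intros c)
  qed (use \<Delta> mono top bot in auto)
  define D where "D = (\<lambda>z. z / u) ` D'"
  have "open D" unfolding D_def eq using D'(1) by (rule op)
  moreover have "D' homeomorphic D"
    unfolding homeomorphic_def homeomorphism_def D_def using u
    by (intro exI[of _ "\<lambda>z. z / u"] exI[of _ "\<lambda>z. u * z"])
       (auto intro!: continuous_intros simp: image_image)
  then have "simply_connected D" using D'(2) homeomorphic_simply_connected by blast
  moreover have "D \<subseteq> \<Delta>" using D'(3) u by (auto simp: D_def)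
  moreover have "range \<gamma> \<subseteq> D" using D'(4) u by (auto simp: D_def eq)
  ultimately show ?thesis by (auto simp: branch_domain_def)
qed

section \<open>The expansion\<close>

lemma Gcoeff_holomorphic:
  assumes "open D" "\<psi> holomorphic_on D" "\<omega> holomorphic_on D"
  shows "Gcoeff \<psi> \<omega> s holomorphic_on D"
  by (induction s) (auto intro!: holomorphic_intros holomorphic_deriv assms)

text \<open>The recursion telescopes: each second derivative splits into a multiple of u^2 + \<psi>
  and a difference of consecutive terms. The end terms are the forcing, since G_0 = -\<omega>, and
  the residual G_m / u^(2m) that drives the error.\<close>

lemma partial_expansion_derivatives:
  assumes D: "open D" and \<psi>: "\<psi> holomorphic_on D" and \<omega>: "\<omega> holomorphic_on D"
    and u: "u \<noteq> 0" and z: "z \<in> D"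
  shows "deriv (deriv (\<lambda>z. 1 / u\<^sup>2 * (\<Sum>s<m. Gcoeff \<psi> \<omega> s z / u ^ (2 * s)))) z =
    (u\<^sup>2 + \<psi> z) * (1 / u\<^sup>2 * (\<Sum>s<m. Gcoeff \<psi> \<omega> s z / u ^ (2 * s))) + \<omega> z + Gcoeff \<psi> \<omega> m z / u ^ (2 * m)"
proof -
  let ?G = "Gcoeff \<psi> \<omega>"
  note G = Gcoeff_holomorphic[OF D \<psi> \<omega>]
  have 1: "((\<lambda>z. 1 / u\<^sup>2 * (\<Sum>s<m. ?G s z / u ^ (2 * s))) has_field_derivative
      1 / u\<^sup>2 * (\<Sum>s<m. deriv (?G s) w / u ^ (2 * s))) (at w)" if "w \<in> D" for w
    by (intro DERIV_cmult DERIV_sum DERIV_cdivide holomorphic_derivI[OF G D that])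
  have "((\<lambda>z. 1 / u\<^sup>2 * (\<Sum>s<m. deriv (?G s) z / u ^ (2 * s))) has_field_derivative
      1 / u\<^sup>2 * (\<Sum>s<m. deriv (deriv (?G s)) z / u ^ (2 * s))) (at z)"
    by (intro DERIV_cmult DERIV_sum DERIV_cdivide holomorphic_derivI[OF holomorphic_deriv[OF G D] D z])
  then have "deriv (deriv (\<lambda>z. 1 / u\<^sup>2 * (\<Sum>s<m. ?G s z / u ^ (2 * s)))) z =
      1 / u\<^sup>2 * (\<Sum>s<m. deriv (deriv (?G s)) z / u ^ (2 * s))"
    by (intro DERIV_imp_deriv has_field_derivative_deriv[OF D 1 _ z])
  also have "(\<Sum>s<m. deriv (deriv (?G s)) z / u ^ (2 * s)) =
      (\<Sum>s<m. u\<^sup>2 * (?G (Suc s) z / u ^ (2 * Suc s) - ?G s z / u ^ (2 * s)) +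
        (u\<^sup>2 + \<psi> z) * (?G s z / u ^ (2 * s)))"
    using u by (intro sum.cong refl) (simp add: divide_simps power2_eq_square algebra_simps)
  also have "\<dots> = u\<^sup>2 * (?G m z / u ^ (2 * m) - ?G 0 z) +
      (u\<^sup>2 + \<psi> z) * (\<Sum>s<m. ?G s z / u ^ (2 * s))"
    unfolding sum.distrib sum_distrib_left[symmetric]
    by (subst sum_lessThan_telescope) simp
  also have "1 / u\<^sup>2 * (u\<^sup>2 * (a - b) + c * S) = c * (1 / u\<^sup>2 * S) - b + a" for a b c S :: complex
    using u by (simp add: field_simps)
  finally show ?thesis
    by simp
qed

lemma bound_terms_bounds:
  assumes "bound_terms_exist \<psi> \<omega> m \<gamma>"
  shows "norm (Gcoeff \<psi> \<omega> m (\<gamma> \<tau>)) + 1 / 2 * arc_integral (deriv (Gcoeff \<psi> \<omega> m)) \<gamma> \<le> Lconst \<psi> \<omega> m \<gamma>"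
  using assms unfolding Lconst_def bound_terms_exist_def
  by (intro add_right_mono cSUP_upper) auto

lemma arc_integral_nonneg: "0 \<le> arc_integral h \<gamma>"
  unfolding arc_integral_def arc_density_def by (intro integral_nonneg_AE) auto

text \<open>The bound depends on \<xi> only through |G_m(\<xi>)|, hence is uniform along the path.
  Two solutions obeying it therefore have a bounded difference, which is what uniqueness asks
  for.\<close>

lemma error_bound_bounded:
  assumes "bound_terms_exist \<psi> \<omega> m \<gamma>"
  shows "\<exists>C. \<forall>\<tau>. error_bound u \<psi> \<omega> m \<gamma> (\<gamma> \<tau>) \<le> C"
proof (intro exI allI)
  fix \<tau>
  show "error_bound u \<psi> \<omega> m \<gamma> (\<gamma> \<tau>) \<le> 1 / norm u ^ (2 * m + 2) * Lconst \<psi> \<omega> m \<gamma> +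
     Lconst \<psi> \<omega> m \<gamma> / (2 * norm u ^ (2 * m + 3)) *
       inverse (1 - 1 / (2 * norm u) * arc_integral \<psi> \<gamma>) * arc_integral \<psi> \<gamma>"
    unfolding error_bound_def
    by (intro add_right_mono mult_left_mono bound_terms_bounds assms) simp
qed

section \<open>Existence and uniqueness along one path\<close>

context monotone_path
begin

text \<open>The inhomogeneity cancels in the difference. Any constant \<open>C\<close> will do, so
  bounds coming from other paths or other truncations can be fed in.\<close>

lemma bounded_difference_of_solutions:
  assumes \<psi>: "\<psi> holomorphic_on D" "arc_integrable \<psi> \<gamma>" "arc_integral \<psi> \<gamma> < 2 * norm u"
    and W: "solution_on D u \<psi> \<omega> W1" "solution_on D u \<psi> \<omega> W2"
    and C: "\<And>\<tau>. norm (W1 (\<gamma> \<tau>) - W2 (\<gamma> \<tau>)) \<le> C" and z: "z \<in> D"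
  shows "W1 z = W2 z"
proof -
  have h: "W1 holomorphic_on D" "W2 holomorphic_on D"
    using W by (auto simp: solution_on_def)
  have "W1 z - W2 z = 0"
  proof (rule bounded_homogeneous_solution_zero[where h="\<lambda>z. W1 z - W2 z", OF \<psi> _ _ _ z])
    show "norm (W1 (\<gamma> \<tau>) - W2 (\<gamma> \<tau>)) \<le> C" for \<tau> by (rule C)
    show "(\<lambda>z. W1 z - W2 z) holomorphic_on D" by (intro holomorphic_intros h)
    fix z assume z: "z \<in> D"
    have "((\<lambda>z. W1 z - W2 z) has_field_derivative deriv W1 w - deriv W2 w) (at w)" if "w \<in> D" for w
      by (intro DERIV_diff holomorphic_derivI[OF _ openD that] h)
    moreover have "((\<lambda>w. deriv W1 w - deriv W2 w) has_field_derivative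
        deriv (deriv W1) z - deriv (deriv W2) z) (at z)"
      by (intro DERIV_diff holomorphic_derivI[OF _ openD z] holomorphic_deriv openD h)
    ultimately have "(deriv (\<lambda>z. W1 z - W2 z) has_field_derivative
        deriv (deriv W1) z - deriv (deriv W2) z) (at z)"
      by (rule has_field_derivative_deriv[OF openD _ _ z])
    then have "deriv (deriv (\<lambda>z. W1 z - W2 z)) z = deriv (deriv W1) z - deriv (deriv W2) z"
      by (rule DERIV_imp_deriv)
    moreover have "deriv (deriv W1) z - (u\<^sup>2 + \<psi> z) * W1 z = \<omega> z"
      "deriv (deriv W2) z - (u\<^sup>2 + \<psi> z) * W2 z = \<omega> z"
      using W z by (auto simp: solution_on_def)
    ultimately show "deriv (deriv (\<lambda>z. W1 z - W2 z)) z = (u\<^sup>2 + \<psi> z) * (W1 z - W2 z)"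
      by (simp add: algebra_simps)
  qed
  then show ?thesis by simp
qed

text \<open>The $G$-part of the integral equation, integrated by parts once so that only \<open>deriv G\<close> has to be
  integrable; the boundary terms produce \<open>G\<close> itself.\<close>

lemma leading_error:
  assumes G: "G holomorphic_on D" "arc_integrable (deriv G) \<gamma>"
  shows "\<exists>f. f holomorphic_on D \<and> (\<forall>z\<in>D. deriv (deriv f) z = u\<^sup>2 * f z - G z * u\<^sup>2 / u ^ (2 * m + 2)) \<and>
    (\<forall>\<tau>. norm (f (\<gamma> \<tau>)) \<le> 1 / norm u ^ (2 * m + 2) * (norm (G (\<gamma> \<tau>)) + 1 / 2 * arc_integral (deriv G) \<gamma>)) \<and>
    (\<forall>\<tau>. norm (deriv f (\<gamma> \<tau>)) \<le> norm u * (1 / norm u ^ (2 * m + 2) * (1 / 2 * arc_integral (deriv G) \<gamma>)))"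
proof -
  let ?I = "arc_integral (deriv G) \<gamma>"
  obtain p q where
    p: "\<And>z. z \<in> D \<Longrightarrow> (p has_field_derivative deriv G z - u * p z) (at z)" and
    q: "\<And>z. z \<in> D \<Longrightarrow> (q has_field_derivative u * q z - deriv G z) (at z)" and
    pq: "\<And>\<tau>. norm (p (\<gamma> \<tau>)) + norm (q (\<gamma> \<tau>)) \<le> ?I"
    by (rule resolvent[OF holomorphic_deriv[OF G(1) openD] G(2)]) auto
  define k where "k = 1 / u ^ (2 * m + 2)"
  have nk: "norm k = 1 / norm u ^ (2 * m + 2)" by (simp add: k_def norm_divide norm_power norm_mult)
  \<comment> \<open>With p and q formed from G', integration by parts turns the two integrals with G
    into (G - p)/u and (G + q)/u; half their sum is (G - (p - q)/2)/u.\<close>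
  define f where "f z = k * (G z - (p z - q z) / 2)" for z
  have f1: "(f has_field_derivative k * (u * (p z + q z) / 2)) (at z)" if "z \<in> D" for z
  proof -
    have "(f has_field_derivative
        k * (deriv G z - ((deriv G z - u * p z) - (u * q z - deriv G z)) / 2)) (at z)"
      unfolding f_def[abs_def]
      by (intro DERIV_cmult DERIV_diff DERIV_cdivide holomorphic_derivI[OF G(1) openD] p q that)
    \<comment> \<open>The terms with G' cancel, so f' is controlled by the arc integral of G'
      although G' may be unbounded on the path.\<close>
    also have "deriv G z - ((deriv G z - u * p z) - (u * q z - deriv G z)) / 2 = u * (p z + q z) / 2"
      by (simp add: field_simps)
    finally show ?thesis .
  qed
  have f2: "(deriv f has_field_derivative u\<^sup>2 * f z - G z * u\<^sup>2 / u ^ (2 * m + 2)) (at z)" if "z \<in> D" for z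
  proof -
    have "((\<lambda>z. k * (u * (p z + q z) / 2)) has_field_derivative u\<^sup>2 * f z - G z * u\<^sup>2 * k) (at z)"
    proof -
      have "((\<lambda>z. k * (u * (p z + q z) / 2)) has_field_derivative
          k * (u * ((deriv G z - u * p z) + (u * q z - deriv G z)) / 2)) (at z)"
        by (intro DERIV_cmult DERIV_add DERIV_cdivide p q that)
      also have "k * (u * ((deriv G z - u * p z) + (u * q z - deriv G z)) / 2) = u\<^sup>2 * f z - G z * u\<^sup>2 * k"
        by (simp add: field_simps f_def power2_eq_square)
      finally show ?thesis .
    qed
    then have "((\<lambda>z. k * (u * (p z + q z) / 2)) has_field_derivative u\<^sup>2 * f z - G z * u\<^sup>2 / u ^ (2 * m + 2)) (at z)"
      by (simp add: k_def)
    then show ?thesis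
      using has_field_derivative_deriv[OF openD f1] that by blast
  qed
  have fh: "f holomorphic_on D" using f1 openD by (auto simp: holomorphic_on_open)
  have "norm (f (\<gamma> \<tau>)) \<le> 1 / norm u ^ (2 * m + 2) * (norm (G (\<gamma> \<tau>)) + 1 / 2 * ?I)" for \<tau>
    unfolding f_def norm_mult nk
  proof (rule mult_left_mono)
    have "norm ((p (\<gamma> \<tau>) - q (\<gamma> \<tau>)) / 2) \<le> 1 / 2 * ?I"
      using pq[of \<tau>] norm_triangle_ineq4[of "p (\<gamma> \<tau>)" "q (\<gamma> \<tau>)"] by (simp add: norm_divide)
    then show "norm (G (\<gamma> \<tau>) - (p (\<gamma> \<tau>) - q (\<gamma> \<tau>)) / 2) \<le> norm (G (\<gamma> \<tau>)) + 1 / 2 * ?I"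
      using norm_triangle_ineq4[of "G (\<gamma> \<tau>)" "(p (\<gamma> \<tau>) - q (\<gamma> \<tau>)) / 2"] by linarith
  qed simp
  moreover have "norm (deriv f (\<gamma> \<tau>)) \<le> norm u * (1 / norm u ^ (2 * m + 2) * (1 / 2 * ?I))" for \<tau>
  proof -
    have "norm (p (\<gamma> \<tau>) + q (\<gamma> \<tau>)) \<le> ?I"
      using pq[of \<tau>] norm_triangle_ineq[of "p (\<gamma> \<tau>)" "q (\<gamma> \<tau>)"] by linarith
    then have "norm k * (norm u * (norm (p (\<gamma> \<tau>) + q (\<gamma> \<tau>)) / 2)) \<le> norm k * (norm u * (?I / 2))"
      by (intro mult_left_mono divide_right_mono) auto
    then show ?thesis
      unfolding DERIV_imp_deriv[OF f1[OF in_D]] nk[symmetric] by (simp add: norm_mult norm_divide mult_ac)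
  qed
  ultimately show ?thesis
    using fh f2 by (intro exI[of _ f]) (auto intro: DERIV_imp_deriv)
qed

text \<open>The zeroth term of the series is estimated pointwise by |f|, only the later ones by the
  uniform constant \<open>A\<close>. This is why |G_n(\<xi>)| stands in the first brace of the final
  bound and the supremum only in the part with the integral of \<psi>.\<close>

lemma bounded_perturbed_solution:
  assumes \<psi>: "\<psi> holomorphic_on D" "arc_integrable \<psi> \<gamma>" "arc_integral \<psi> \<gamma> < 2 * norm u"
    and f: "f holomorphic_on D" and A: "\<And>\<tau>. norm (f (\<gamma> \<tau>)) \<le> A" "\<And>\<tau>. norm (deriv f (\<gamma> \<tau>)) \<le> norm u * A"
  shows "\<exists>F. F holomorphic_on D \<and>
    (\<forall>z\<in>D. deriv (deriv F) z = deriv (deriv f) z + u\<^sup>2 * (F z - f z) + \<psi> z * F z) \<and>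
    (\<forall>\<tau>. norm (F (\<gamma> \<tau>)) \<le> norm (f (\<gamma> \<tau>)) + A * (1 / (2 * norm u) * arc_integral \<psi> \<gamma>) *
      inverse (1 - 1 / (2 * norm u) * arc_integral \<psi> \<gamma>))"
proof -
  define \<kappa> where "\<kappa> = arc_integral \<psi> \<gamma> / (2 * norm u)"
  have \<kappa>: "0 \<le> \<kappa>" "\<kappa> < 1"
    using \<psi>(3) u arc_integral_nonneg[of \<psi> \<gamma>] by (auto simp: \<kappa>_def)
  have A0: "A \<ge> 0" using A(1)[of 0] norm_ge_zero order_trans by blast
  \<comment> \<open>The clause for n = 0 pins the start of the chosen sequence to \<open>f\<close>;
    otherwise any function with the right bounds could begin it.\<close>
  define P where "P n g \<longleftrightarrow> g holomorphic_on D \<and> (\<forall>\<tau>. norm (g (\<gamma> \<tau>)) \<le> \<kappa> ^ n * A) \<and>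
    (\<forall>\<tau>. norm (deriv g (\<gamma> \<tau>)) \<le> \<kappa> ^ n * (norm u * A)) \<and> (n = 0 \<longrightarrow> g = f)" for n g
  define R where "R g v \<longleftrightarrow> (\<forall>z\<in>D. deriv (deriv v) z = u\<^sup>2 * v z + \<psi> z * g z)" for g v
  have "\<exists>h. \<forall>n. P n (h n) \<and> R (h n) (h (Suc n))"
  proof (rule dependent_nat_choice)
    show "\<exists>g. P 0 g" using f A by (auto simp: P_def)
    fix g n assume g: "P n g"
    obtain v where v: "v holomorphic_on D"
      "\<And>z. z \<in> D \<Longrightarrow> (deriv v has_field_derivative u\<^sup>2 * v z + \<psi> z * g z) (at z)"
      "\<And>\<tau>. norm (v (\<gamma> \<tau>)) \<le> \<kappa> * (\<kappa> ^ n * A)"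
      "\<And>\<tau>. norm (deriv v (\<gamma> \<tau>)) \<le> \<kappa> * (norm u * (\<kappa> ^ n * A))"
      using resolvent_solution[OF \<psi>(1,2), of g "\<kappa> ^ n * A"] g unfolding P_def \<kappa>_def[symmetric] by auto
    have "P (Suc n) v" using v(1,3,4) by (simp add: P_def algebra_simps)
    moreover have "R g v" using v(2) by (auto simp: R_def intro: DERIV_imp_deriv)
    ultimately show "\<exists>v. P (Suc n) v \<and> R g v" by blast
  qed
  then obtain h where h: "\<And>n. P n (h n)" "\<And>n. R (h n) (h (Suc n))" by blast
  have h0: "h 0 = f" using h(1)[of 0] by (simp add: P_def)
  have hh: "h n holomorphic_on D" and hb: "norm (h n (\<gamma> \<tau>)) \<le> \<kappa> ^ n * A"
    and hb': "norm (deriv (h n) (\<gamma> \<tau>)) \<le> \<kappa> ^ n * (norm u * A)" for n \<tau>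
    using h(1)[of n] by (auto simp: P_def)
  have s\<kappa>: "summable (\<lambda>n. \<kappa> ^ n * c)" for c
    using \<kappa> by (intro summable_mult2 summable_geometric) auto
  have "summable (\<lambda>n. norm (h n (\<gamma> 0)) + norm (deriv (h n) (\<gamma> 0)))"
    by (rule summable_comparison_test'[OF summable_add[OF s\<kappa> s\<kappa>], of 0])
       (use hb hb' in \<open>auto intro!: add_mono\<close>)
  then obtain F where F: "F holomorphic_on D" "\<And>z. z \<in> D \<Longrightarrow> (\<lambda>m. h m z) sums F z"
    "\<And>z. z \<in> D \<Longrightarrow> deriv (deriv F) z = deriv (deriv (h 0)) z + u\<^sup>2 * (F z - h 0 z) + \<psi> z * F z"
    using h(2) by (elim neumann_series[OF openD connD \<psi>(1) hh _ in_D, rotated]) (auto simp: R_def)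
  have "norm (F (\<gamma> \<tau>)) \<le> norm (f (\<gamma> \<tau>)) + A * \<kappa> * inverse (1 - \<kappa>)" for \<tau>
  proof -
    have sums: "(\<lambda>m. h (Suc m) (\<gamma> \<tau>)) sums (F (\<gamma> \<tau>) - f (\<gamma> \<tau>))"
      using F(2)[OF in_D, of \<tau>] sums_Suc_iff[of "\<lambda>m. h m (\<gamma> \<tau>)" "F (\<gamma> \<tau>) - f (\<gamma> \<tau>)"] by (simp add: h0)
    have g: "(\<lambda>n. \<kappa> ^ n * (\<kappa> * A)) sums (1 / (1 - \<kappa>) * (\<kappa> * A))"
      using \<kappa> by (intro sums_mult2 geometric_sums) auto
    have "norm (\<Sum>m. h (Suc m) (\<gamma> \<tau>)) \<le> (\<Sum>n. \<kappa> ^ n * (\<kappa> * A))"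
      by (rule norm_suminf_le) (use hb[of "Suc _" \<tau>] s\<kappa> in \<open>auto simp: algebra_simps\<close>)
    then have "norm (F (\<gamma> \<tau>) - f (\<gamma> \<tau>)) \<le> 1 / (1 - \<kappa>) * (\<kappa> * A)"
      using sums_unique[OF sums] sums_unique[OF g] by simp
    also have "\<dots> = A * \<kappa> * inverse (1 - \<kappa>)" by (simp add: divide_inverse)
    finally show ?thesis using norm_triangle_sub[of "F (\<gamma> \<tau>)" "f (\<gamma> \<tau>)"] by linarith
  qed
  then show ?thesis
    using F by (intro exI[of _ F]) (simp add: h0 \<kappa>_def)
qed

text \<open>The solution is the truncated expansion plus the Neumann sum started from the leading
  error, so that sum is exactly \<open>eps\<close>. Every truncation \<open>m\<close> is covered,
  and different \<open>m\<close> may a priori give different solutions.\<close>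

lemma expansion_solution:
  assumes \<psi>: "\<psi> holomorphic_on D" "arc_integrable \<psi> \<gamma>" "arc_integral \<psi> \<gamma> < 2 * norm u"
    and \<omega>: "\<omega> holomorphic_on D" and bt: "bound_terms_exist \<psi> \<omega> m \<gamma>"
  shows "\<exists>W. solution_on D u \<psi> \<omega> W \<and>
    (\<forall>\<tau>. norm (eps u \<psi> \<omega> W m (\<gamma> \<tau>)) \<le> error_bound u \<psi> \<omega> m \<gamma> (\<gamma> \<tau>))"
proof -
  let ?G = "Gcoeff \<psi> \<omega>"
  note G = Gcoeff_holomorphic[OF openD \<psi>(1) \<omega>]
  define A where "A = 1 / norm u ^ (2 * m + 2) * Lconst \<psi> \<omega> m \<gamma>"
  have "arc_integrable (deriv (?G m)) \<gamma>" using bt by (simp add: bound_terms_exist_def)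
  from leading_error[OF G this, of m] obtain f where f: "f holomorphic_on D"
    "\<And>z. z \<in> D \<Longrightarrow> deriv (deriv f) z = u\<^sup>2 * f z - ?G m z * u\<^sup>2 / u ^ (2 * m + 2)"
    "\<And>\<tau>. norm (f (\<gamma> \<tau>)) \<le> 1 / norm u ^ (2 * m + 2) * (norm (?G m (\<gamma> \<tau>)) + 1 / 2 * arc_integral (deriv (?G m)) \<gamma>)"
    "\<And>\<tau>. norm (deriv f (\<gamma> \<tau>)) \<le> norm u * (1 / norm u ^ (2 * m + 2) * (1 / 2 * arc_integral (deriv (?G m)) \<gamma>))"
    by blast
  have fA: "norm (f (\<gamma> \<tau>)) \<le> A" for \<tau>
    unfolding A_def by (rule order_trans[OF f(3)]) (intro mult_left_mono bound_terms_bounds bt, simp)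
  have fA': "norm (deriv f (\<gamma> \<tau>)) \<le> norm u * A" for \<tau>
  proof (rule order_trans[OF f(4)])
    have "1 / 2 * arc_integral (deriv (?G m)) \<gamma> \<le> Lconst \<psi> \<omega> m \<gamma>"
      using bound_terms_bounds[OF bt, of \<tau>] norm_ge_zero[of "?G m (\<gamma> \<tau>)"] by linarith
    then show "norm u * (1 / norm u ^ (2 * m + 2) * (1 / 2 * arc_integral (deriv (?G m)) \<gamma>)) \<le> norm u * A"
      unfolding A_def by (intro mult_left_mono) auto
  qed
  obtain F where F: "F holomorphic_on D"
    "\<And>z. z \<in> D \<Longrightarrow> deriv (deriv F) z = deriv (deriv f) z + u\<^sup>2 * (F z - f z) + \<psi> z * F z"
    "\<And>\<tau>. norm (F (\<gamma> \<tau>)) \<le> norm (f (\<gamma> \<tau>)) + A * (1 / (2 * norm u) * arc_integral \<psi> \<gamma>) *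
      inverse (1 - 1 / (2 * norm u) * arc_integral \<psi> \<gamma>)"
    using bounded_perturbed_solution[OF \<psi> f(1) fA fA'] by blast
  define T where "T z = 1 / u\<^sup>2 * (\<Sum>s<m. ?G s z / u ^ (2 * s))" for z
  have Th: "T holomorphic_on D"
    unfolding T_def[abs_def] using u by (intro holomorphic_intros G) auto
  have T2: "deriv (deriv T) z = (u\<^sup>2 + \<psi> z) * T z + \<omega> z + ?G m z / u ^ (2 * m)" if "z \<in> D" for z
    unfolding T_def[abs_def] by (rule partial_expansion_derivatives[OF openD \<psi>(1) \<omega> u that])
  define W where "W z = F z + T z" for z
  have "solution_on D u \<psi> \<omega> W"
    unfolding solution_on_def
  proof (intro conjI ballI)
    show "W holomorphic_on D" unfolding W_def[abs_def] by (intro holomorphic_intros F Th)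
    fix z assume z: "z \<in> D"
    have "(W has_field_derivative deriv F w + deriv T w) (at w)" if "w \<in> D" for w
      unfolding W_def[abs_def] by (intro DERIV_add holomorphic_derivI[OF _ openD that] F Th)
    moreover have "((\<lambda>w. deriv F w + deriv T w) has_field_derivative deriv (deriv F) z + deriv (deriv T) z) (at z)"
      by (intro DERIV_add holomorphic_derivI[OF _ openD z] holomorphic_deriv openD F Th)
    ultimately have "deriv (deriv W) z = deriv (deriv F) z + deriv (deriv T) z"
      by (intro DERIV_imp_deriv has_field_derivative_deriv[OF openD _ _ z])
    moreover have "?G m z * u\<^sup>2 / u ^ (2 * m + 2) = ?G m z / u ^ (2 * m)"
      using u by (simp add: power_add power2_eq_square)
    ultimately show "deriv (deriv W) z - (u\<^sup>2 + \<psi> z) * W z = \<omega> z"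
      using F(2)[OF z] T2[OF z] f(2)[OF z] by (simp add: W_def algebra_simps)
  qed
  moreover have "norm (eps u \<psi> \<omega> W m (\<gamma> \<tau>)) \<le> error_bound u \<psi> \<omega> m \<gamma> (\<gamma> \<tau>)" for \<tau>
  proof -
    have "eps u \<psi> \<omega> W m (\<gamma> \<tau>) = F (\<gamma> \<tau>)" by (simp add: eps_def W_def T_def)
    moreover have "A * (1 / (2 * norm u) * arc_integral \<psi> \<gamma>) * inverse (1 - 1 / (2 * norm u) * arc_integral \<psi> \<gamma>) =
      Lconst \<psi> \<omega> m \<gamma> / (2 * norm u ^ (2 * m + 3)) *
       inverse (1 - 1 / (2 * norm u) * arc_integral \<psi> \<gamma>) * arc_integral \<psi> \<gamma>"
      by (simp add: A_def eval_nat_numeral mult_ac)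
    ultimately show ?thesis
      using order_trans[OF F(3) add_right_mono[OF f(3)], of \<tau>] unfolding error_bound_def by simp
  qed
  ultimately show ?thesis by blast
qed

end

section \<open>Infinite ends of linking paths\<close>

lemma arc_ends_tend:
  assumes end_: "infinite_end \<Delta> u j a" and same: "same_end \<gamma> a"
  shows "filterlim (\<lambda>\<tau>. (-1) ^ j * Re (u * \<gamma> \<tau>)) at_top at_top"
proof -
  obtain T S \<phi> where \<phi>: "strict_mono_on {T..} \<phi>" "\<phi> ` {T..} = {S..}" "\<And>\<tau>. \<tau> \<ge> T \<Longrightarrow> \<gamma> \<tau> = a (\<phi> \<tau>)"
    using same unfolding same_end_def by blast
  have "filterlim \<phi> at_top at_top"
    unfolding filterlim_at_top
  proof
    fix Z
    have "max S Z \<in> \<phi> ` {T..}" using \<phi>(2) by simp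
    then obtain t where t: "T \<le> t" "\<phi> t = max S Z" by auto
    have "Z \<le> \<phi> \<tau>" if "t \<le> \<tau>" for \<tau>
      using strict_mono_on_leD[OF \<phi>(1), of t \<tau>] t that by auto
    then show "\<forall>\<^sub>F \<tau> in at_top. Z \<le> \<phi> \<tau>"
      by (auto simp: eventually_at_top_linorder)
  qed
  then have "filterlim (\<lambda>\<tau>. (-1) ^ j * Re (u * a (\<phi> \<tau>))) at_top at_top"
    using end_ unfolding infinite_end_def by (auto intro: filterlim_compose)
  then show ?thesis
  proof (rule filterlim_mono_eventually[OF _ order_refl order_refl])
    show "\<forall>\<^sub>F \<tau> in at_top. (-1) ^ j * Re (u * a (\<phi> \<tau>)) = (-1) ^ j * Re (u * \<gamma> \<tau>)"
      using eventually_ge_at_top[of T] by eventually_elim (simp only: \<phi>(3))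
  qed
qed

text \<open>Far out, \<gamma> runs on the arc \<open>a\<close> at parameters beyond
  \<open>S'\<close>; the reparametrization of \<delta> is onto there, so \<delta> passes through the
  same points.\<close>

lemma same_end_common_tail:
  assumes "same_end \<gamma> a" "same_end \<delta> a"
  shows "\<exists>T. \<forall>\<tau>\<ge>T. \<gamma> \<tau> \<in> range \<delta>"
proof -
  obtain T S \<phi> where \<phi>: "strict_mono_on {T..} \<phi>" "\<phi> ` {T..} = {S..}" "\<And>\<tau>. \<tau> \<ge> T \<Longrightarrow> \<gamma> \<tau> = a (\<phi> \<tau>)"
    using assms(1) unfolding same_end_def by blast
  obtain T' S' \<phi>' where \<phi>': "\<phi>' ` {T'..} = {S'..}" "\<And>\<tau>. \<tau> \<ge> T' \<Longrightarrow> \<delta> \<tau> = a (\<phi>' \<tau>)"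
    using assms(2) unfolding same_end_def by blast
  have "max S S' \<in> \<phi> ` {T..}" using \<phi>(2) by simp
  then obtain t where t: "T \<le> t" "\<phi> t = max S S'" by auto
  have "\<gamma> \<tau> \<in> range \<delta>" if "t \<le> \<tau>" for \<tau>
  proof -
    have "S' \<le> \<phi> \<tau>"
      using strict_mono_on_leD[OF \<phi>(1), of t \<tau>] t that by auto
    then have "\<phi> \<tau> \<in> \<phi>' ` {T'..}" using \<phi>'(1) by simp
    then obtain r where "T' \<le> r" "\<phi>' r = \<phi> \<tau>" by auto
    then have "\<gamma> \<tau> = \<delta> r" using \<phi>(3)[of \<tau>] \<phi>'(2)[of r] t that by simp
    then show ?thesis by simp
  qed
  then show ?thesis by blast
qed

lemma linking_path_in_domain:
  assumes "linking_path \<Delta> u \<alpha> \<gamma>"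
  shows "range \<gamma> \<subseteq> \<Delta>"
proof
  fix z assume "z \<in> range \<gamma>"
  then have "z \<in> Xi \<Delta> u \<alpha> 1"
    using assms unfolding linking_path_def by blast
  then obtain t :: "real \<Rightarrow> complex" where "t ` {0..} \<subseteq> \<Delta>" "t 0 = z"
    unfolding Xi_def by blast
  then show "z \<in> \<Delta>" by force
qed

text \<open>The ends fix the direction: the sign (-1)^1 at \<alpha>_1 makes Re (u \<gamma>) tend to
  -\<infinity> on the left, and the growth towards \<alpha>_2 excludes the antimonotone
  alternative.\<close>

lemma linking_path_monotone:
  assumes ends: "infinite_end \<Delta> u 1 (\<alpha> 1)" "infinite_end \<Delta> u 2 (\<alpha> 2)" and \<gamma>: "linking_path \<Delta> u \<alpha> \<gamma>"
  shows "filterlim (\<lambda>\<tau>. Re (u * \<gamma> \<tau>)) at_top at_top" "filterlim (\<lambda>\<tau>. Re (u * \<gamma> \<tau>)) at_bot at_bot"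
    "mono (\<lambda>\<tau>. Re (u * \<gamma> \<tau>))"
proof -
  have "same_end (\<lambda>\<tau>. \<gamma> (- \<tau>)) (\<alpha> 1)" "same_end \<gamma> (\<alpha> 2)"
    and mono: "mono (\<lambda>\<tau>. Re (u * \<gamma> \<tau>)) \<or> antimono (\<lambda>\<tau>. Re (u * \<gamma> \<tau>))"
    using \<gamma> by (auto simp: linking_path_def)
  then have 1: "filterlim (\<lambda>\<tau>. - Re (u * \<gamma> (- \<tau>))) at_top at_top"
    and 2: "filterlim (\<lambda>\<tau>. Re (u * \<gamma> \<tau>)) at_top at_top"
    using arc_ends_tend[OF ends(1)] arc_ends_tend[OF ends(2)] by force+
  show "filterlim (\<lambda>\<tau>. Re (u * \<gamma> \<tau>)) at_top at_top" by (rule 2)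
  show "filterlim (\<lambda>\<tau>. Re (u * \<gamma> \<tau>)) at_bot at_bot"
    using 1 unfolding filterlim_at_bot_mirror filterlim_uminus_at_top minus_minus .
  have "\<forall>\<^sub>F \<tau> in at_top. Re (u * \<gamma> 0) < Re (u * \<gamma> \<tau>)"
    using 2 unfolding filterlim_at_top_dense by blast
  then have "\<forall>\<^sub>F \<tau> in at_top. 0 \<le> \<tau> \<and> Re (u * \<gamma> 0) < Re (u * \<gamma> \<tau>)"
    by (intro eventually_conj eventually_ge_at_top)
  then obtain \<tau> :: real where "0 \<le> \<tau>" "Re (u * \<gamma> 0) < Re (u * \<gamma> \<tau>)"
    by (auto simp: eventually_at_top_linorder)
  then have "\<not> antimono (\<lambda>\<tau>. Re (u * \<gamma> \<tau>))"
    unfolding monotone_def by fastforce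
  with mono show "mono (\<lambda>\<tau>. Re (u * \<gamma> \<tau>))" by blast
qed

lemma linking_path_locale:
  assumes "infinite_end \<Delta> u 1 (\<alpha> 1)" "infinite_end \<Delta> u 2 (\<alpha> 2)" and \<gamma>: "linking_path \<Delta> u \<alpha> \<gamma>"
    and "u \<noteq> 0" "branch_domain \<Delta> D" "range \<gamma> \<subseteq> D"
  shows "monotone_path D u \<gamma>"
  using assms linking_path_monotone[OF assms(1-3)] R2_chain_path_derivative[of \<gamma>]
  unfolding monotone_path_def branch_domain_def linking_path_def by blast

text \<open>Outside a compact parameter interval \<gamma> runs within the range of \<delta>, where
  \<open>C\<close> applies; on the interval continuity gives a bound. Boundedness is thereby
  transported from one path to another.\<close>

lemma bounded_along_linking_paths:
  assumes \<gamma>: "linking_path \<Delta> u \<alpha> \<gamma>" and \<delta>: "linking_path \<Delta> u \<alpha> \<delta>"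
    and f: "continuous_on UNIV (\<lambda>\<tau>. f (\<gamma> \<tau>))" and C: "\<And>\<tau>. norm (f (\<delta> \<tau>) :: complex) \<le> C"
  shows "\<exists>M. \<forall>\<tau>. norm (f (\<gamma> \<tau>)) \<le> M"
proof -
  obtain T2 where T2: "\<And>\<tau>. \<tau> \<ge> T2 \<Longrightarrow> \<gamma> \<tau> \<in> range \<delta>"
    using same_end_common_tail[of \<gamma> "\<alpha> 2" \<delta>] \<gamma> \<delta> by (auto simp: linking_path_def)
  obtain T1 where T1: "\<And>\<tau>. \<tau> \<ge> T1 \<Longrightarrow> \<gamma> (- \<tau>) \<in> range (\<lambda>\<tau>. \<delta> (- \<tau>))"
    using same_end_common_tail[of "\<lambda>\<tau>. \<gamma> (- \<tau>)" "\<alpha> 1" "\<lambda>\<tau>. \<delta> (- \<tau>)"] \<gamma> \<delta> by (auto simp: linking_path_def)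
  have "compact ((\<lambda>\<tau>. f (\<gamma> \<tau>)) ` {- T1..T2})"
    by (intro compact_continuous_image continuous_on_subset[OF f]) auto
  then have "bounded ((\<lambda>\<tau>. f (\<gamma> \<tau>)) ` {- T1..T2})" by (rule compact_imp_bounded)
  then obtain M where "\<forall>\<tau>\<in>{- T1..T2}. norm (f (\<gamma> \<tau>)) \<le> M"
    unfolding bounded_iff by auto
  then have M: "norm (f (\<gamma> \<tau>)) \<le> M" if "- T1 \<le> \<tau>" "\<tau> \<le> T2" for \<tau>
    using that by simp
  have "norm (f (\<gamma> \<tau>)) \<le> max M C" for \<tau>
  proof (cases "- T1 \<le> \<tau> \<and> \<tau> \<le> T2")
    case True
    then show ?thesis using M by (simp add: max.coboundedI1)
  next
    case False
    have "\<gamma> \<tau> \<in> range \<delta>"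
    proof (cases "\<tau> \<ge> T2")
      case True
      then show ?thesis by (rule T2)
    next
      case 2: False
      then have "\<gamma> (- (- \<tau>)) \<in> range (\<lambda>\<tau>. \<delta> (- \<tau>))" using False by (intro T1) auto
      then show ?thesis by auto
    qed
    then show ?thesis using C by (auto simp: max.coboundedI2)
  qed
  then show ?thesis by blast
qed

text \<open>With the truncation $n + r$ only $G_n$ and $G_{n+r}$ are assumed bounded, but the terms in between
  decide whether the solutions belonging to $n$ and $n + r$ agree.\<close>

lemma (in monotone_path) intermediate_coefficients_bounded:
  assumes \<psi>: "\<psi> holomorphic_on D" "arc_integrable \<psi> \<gamma>" and \<omega>: "\<omega> holomorphic_on D"
    and bt: "bound_terms_exist \<psi> \<omega> m \<gamma>" "bound_terms_exist \<psi> \<omega> (m + r) \<gamma>" and r: "r \<ge> 1"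
  shows "\<exists>M. \<forall>\<tau>. \<forall>s<r. norm (Gcoeff \<psi> \<omega> (m + s) (\<gamma> \<tau>)) \<le> M"
proof -
  let ?G = "Gcoeff \<psi> \<omega>"
  note G = Gcoeff_holomorphic[OF openD \<psi>(1) \<omega>]
  \<comment> \<open>Coefficients and derivatives are interleaved: y (2s) = G_(m+s) and y (2s+1) =
    G_(m+s)'. Since G_(m+s)'' = G_(m+s+1) + \<psi> G_(m+s), the chain of derivatives fails only at
    odd places, and there by a multiple of \<psi>.\<close>
  define y where "y j = (if even j then ?G (m + j div 2) else deriv (?G (m + j div 2)))" for j
  have y: "y j holomorphic_on D" for j
    unfolding y_def using G holomorphic_deriv[OF G openD] by simp
  have step: "norm (deriv (y j) z - y (Suc j) z) \<le> norm (\<psi> z) * (\<Sum>i<2 * r. norm (y i z))" if "j < 2 * r" for j z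
  proof (cases "even j")
    case True
    then have "deriv (y j) z - y (Suc j) z = 0" by (simp add: y_def)
    then show ?thesis by (simp add: sum_nonneg)
  next
    case False
    then obtain i where i: "j = Suc (2 * i)" by (metis oddE Suc_eq_plus1)
    have "deriv (y j) z - y (Suc j) z = \<psi> z * y (2 * i) z" by (simp add: y_def i)
    moreover have "norm (y (2 * i) z) \<le> (\<Sum>i<2 * r. norm (y i z))"
      using that i by (intro member_le_sum) auto
    ultimately show ?thesis by (simp add: norm_mult mult_left_mono)
  qed
  have y0: "y 0 = ?G m" and yN: "y (2 * r) = ?G (m + r)" by (simp_all add: y_def)
  obtain C0 where C0: "\<And>\<tau>. norm (?G m (\<gamma> \<tau>)) \<le> C0"
    using bt(1) unfolding bound_terms_exist_def bdd_above_def by blast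
  obtain C1 where C1: "\<And>\<tau>. norm (?G (m + r) (\<gamma> \<tau>)) \<le> C1"
    using bt(2) unfolding bound_terms_exist_def bdd_above_def by blast
  define C where "C = max C0 C1"
  have C: "norm (y 0 (\<gamma> \<tau>)) \<le> C" "norm (y (2 * r) (\<gamma> \<tau>)) \<le> C" for \<tau>
    using C0[of \<tau>] C1[of \<tau>] by (auto simp: C_def y0 yN)
  let ?d = "\<lambda>\<tau>. vector_derivative \<gamma> (at \<tau>)"
  have i1: "integrable lborel (\<lambda>\<tau>. norm (\<psi> (\<gamma> \<tau>)) * norm (?d \<tau>))"
    using \<psi>(2) unfolding arc_integrable_def arc_density_def[abs_def] .
  have i2: "integrable lborel (\<lambda>\<tau>. norm (deriv (y (2 * r)) (\<gamma> \<tau>)) * norm (?d \<tau>))"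
    using bt(2) unfolding bound_terms_exist_def arc_integrable_def arc_density_def[abs_def] yN by blast
  have le: "Re (u * z) / norm u \<le> norm z" "- Re (u * z) / norm u \<le> norm z" for z
    using abs_Re_le_cmod[of "u * z"] u by (auto simp: norm_mult pos_divide_le_eq mult.commute)
  have inf1: "filterlim (\<lambda>\<tau>. norm (\<gamma> \<tau>)) at_top at_top"
  proof (rule filterlim_at_top_mono)
    show "filterlim (\<lambda>\<tau>. Re (u * \<gamma> \<tau>) * (1 / norm u)) at_top at_top"
      using u by (intro filterlim_at_top_mult_tendsto_pos[OF tendsto_const _ at_top_path]) auto
  qed (use le in auto)
  have inf2: "filterlim (\<lambda>\<tau>. norm (\<gamma> (- \<tau>))) at_top at_top"
  proof (rule filterlim_at_top_mono)
    have "filterlim (\<lambda>\<tau>. - Re (u * \<gamma> (- \<tau>))) at_top at_top"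
      using at_bot_path unfolding filterlim_at_bot_mirror filterlim_uminus_at_top minus_minus .
    then show "filterlim (\<lambda>\<tau>. - Re (u * \<gamma> (- \<tau>)) * (1 / norm u)) at_top at_top"
      using u by (intro filterlim_at_top_mult_tendsto_pos[OF tendsto_const]) auto
  qed (use le in auto)
  have N: "2 * r \<ge> 1" using r by simp
  obtain M1 where M1: "\<forall>\<tau>\<ge>0. \<forall>j<2 * r. norm (y j (\<gamma> \<tau>)) \<le> M1"
    using derivative_chain_bounded[OF deriv_path openD range inf1 N y step i1 i2 C] by blast
  have "\<exists>M. \<forall>\<tau>\<ge>0. \<forall>j<2 * r. norm (y j (\<gamma> (- \<tau>))) \<le> M"
  proof (rule derivative_chain_bounded[OF path_derivative_reverse[OF deriv_path] openD _ inf2 N y step])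
    show "integrable lborel (\<lambda>\<tau>. norm (\<psi> (\<gamma> (- \<tau>))) * norm (- ?d (- \<tau>)))"
      using lborel_integrable_real_affine[OF i1, of "- 1" 0] by simp
    show "integrable lborel (\<lambda>\<tau>. norm (deriv (y (2 * r)) (\<gamma> (- \<tau>))) * norm (- ?d (- \<tau>)))"
      using lborel_integrable_real_affine[OF i2, of "- 1" 0] by simp
  qed (use C range in auto)
  then obtain M2 where M2: "\<forall>\<tau>\<ge>0. \<forall>j<2 * r. norm (y j (\<gamma> (- \<tau>))) \<le> M2" by blast
  have "norm (?G (m + s) (\<gamma> \<tau>)) \<le> max M1 M2" if "s < r" for s \<tau>
  proof (cases "\<tau> \<ge> 0")
    case True
    then have "norm (y (2 * s) (\<gamma> \<tau>)) \<le> M1" using M1 that by simp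
    then show ?thesis by (simp add: y_def max.coboundedI1)
  next
    case False
    then have "norm (y (2 * s) (\<gamma> (- (- \<tau>)))) \<le> M2" using M2[rule_format, of "- \<tau>" "2 * s"] that by simp
    then show ?thesis by (simp add: y_def max.coboundedI2)
  qed
  then show ?thesis by blast
qed

lemma eps_shift:
  "eps u \<psi> \<omega> W n \<xi> = (\<Sum>s = n..<n + r. Gcoeff \<psi> \<omega> s \<xi> / u ^ (2 * s + 2)) + eps u \<psi> \<omega> W (n + r) \<xi>"
proof -
  have eq: "1 / u\<^sup>2 * (\<Sum>s<k. Gcoeff \<psi> \<omega> s \<xi> / u ^ (2 * s)) = (\<Sum>s<k. Gcoeff \<psi> \<omega> s \<xi> / u ^ (2 * s + 2))" for k
    by (simp add: sum_distrib_left power_add power2_eq_square mult_ac)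
  have "(\<Sum>s<n + r. Gcoeff \<psi> \<omega> s \<xi> / u ^ (2 * s + 2)) =
      (\<Sum>s<n. Gcoeff \<psi> \<omega> s \<xi> / u ^ (2 * s + 2)) + (\<Sum>s = n..<n + r. Gcoeff \<psi> \<omega> s \<xi> / u ^ (2 * s + 2))"
    unfolding lessThan_atLeast0 by (simp add: sum.atLeastLessThan_concat)
  then show ?thesis unfolding eps_def eq by simp
qed

theorem theorem4p1:
  fixes \<Delta> :: "complex set" and \<psi> \<omega> :: "complex \<Rightarrow> complex" and u :: complex and n :: nat
    and \<alpha> :: "nat \<Rightarrow> real \<Rightarrow> complex" and \<gamma> :: "real \<Rightarrow> complex"
  assumes "open \<Delta>" and "connected \<Delta>" and "\<not> bounded \<Delta>"
    and "\<psi> holomorphic_on \<Delta>" and "\<omega> holomorphic_on \<Delta>"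
    and "n \<ge> 1" and "u \<noteq> 0"
    and "infinite_end \<Delta> u 1 (\<alpha> 1)" and "infinite_end \<Delta> u 2 (\<alpha> 2)"
    and "admissible_path \<Delta> u \<alpha> \<psi> \<omega> n \<gamma>"
  shows "(\<exists>D. branch_domain \<Delta> D \<and> range \<gamma> \<subseteq> D) \<and>
    (\<forall>D. branch_domain \<Delta> D \<and> range \<gamma> \<subseteq> D \<longrightarrow>
      (\<exists>G. solution_on D u \<psi> \<omega> G \<and>
         (\<forall>\<L> \<xi>. admissible_path \<Delta> u \<alpha> \<psi> \<omega> n \<L> \<and> range \<L> \<subseteq> D \<and> \<xi> \<in> range \<L> \<longrightarrow>
            norm (eps u \<psi> \<omega> G n \<xi>) \<le> error_bound u \<psi> \<omega> n \<L> \<xi> \<and>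
            (\<forall>r\<ge>1. bound_terms_exist \<psi> \<omega> (n + r) \<L> \<longrightarrow>
               norm (eps u \<psi> \<omega> G n \<xi>) \<le>
                 norm (\<Sum>s = n..n + r - 1. Gcoeff \<psi> \<omega> s \<xi> / u ^ (2 * s + 2)) +
                 error_bound u \<psi> \<omega> (n + r) \<L> \<xi>)) \<and>
         (\<forall>H. solution_on D u \<psi> \<omega> H \<and>
              (\<forall>\<xi>\<in>range \<gamma>. norm (eps u \<psi> \<omega> H n \<xi>) \<le> error_bound u \<psi> \<omega> n \<gamma> \<xi>) \<longrightarrow>
              (\<forall>\<xi>\<in>D. H \<xi> = G \<xi>))))"
proof (intro conjI allI impI)
  note D\<Delta> = \<open>open \<Delta>\<close> and ends = \<open>infinite_end \<Delta> u 1 (\<alpha> 1)\<close> \<open>infinite_end \<Delta> u 2 (\<alpha> 2)\<close>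
  have link: "linking_path \<Delta> u \<alpha> \<L>" and i\<psi>: "arc_integrable \<psi> \<L>" "arc_integral \<psi> \<L> < 2 * norm u"
    and bt: "bound_terms_exist \<psi> \<omega> n \<L>" if "admissible_path \<Delta> u \<alpha> \<psi> \<omega> n \<L>" for \<L>
    using that by (auto simp: admissible_path_def)
  note \<gamma> = \<open>admissible_path \<Delta> u \<alpha> \<psi> \<omega> n \<gamma>\<close>
  have "continuous_on UNIV \<gamma>"
    using link[OF \<gamma>] by (simp add: linking_path_def R2_chain_def)
  then show "\<exists>D. branch_domain \<Delta> D \<and> range \<gamma> \<subseteq> D"
    using linking_path_monotone[OF ends link[OF \<gamma>]] linking_path_in_domain[OF link[OF \<gamma>]] \<open>u \<noteq> 0\<close> D\<Delta>
    by (intro branch_domain_exists) auto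
  fix D assume D: "branch_domain \<Delta> D \<and> range \<gamma> \<subseteq> D"
  have hol: "\<psi> holomorphic_on D" "\<omega> holomorphic_on D"
    using D \<open>\<psi> holomorphic_on \<Delta>\<close> \<open>\<omega> holomorphic_on \<Delta>\<close>
    by (auto simp: branch_domain_def intro: holomorphic_on_subset)
  have mp: "monotone_path D u \<L>" if "linking_path \<Delta> u \<alpha> \<L>" "range \<L> \<subseteq> D" for \<L>
    using that D \<open>u \<noteq> 0\<close> by (intro linking_path_locale[OF ends]) auto
  interpret \<gamma>: monotone_path D u \<gamma>
    using D link[OF \<gamma>] by (intro mp) auto
  obtain G where G: "solution_on D u \<psi> \<omega> G"
    "\<And>\<tau>. norm (eps u \<psi> \<omega> G n (\<gamma> \<tau>)) \<le> error_bound u \<psi> \<omega> n \<gamma> (\<gamma> \<tau>)"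
    using \<gamma>.expansion_solution[OF hol(1) i\<psi>[OF \<gamma>] hol(2) bt[OF \<gamma>]] by blast
  obtain C where C: "\<And>\<tau>. error_bound u \<psi> \<omega> n \<gamma> (\<gamma> \<tau>) \<le> C"
    using error_bound_bounded[OF bt[OF \<gamma>]] by blast
  have Gh: "G holomorphic_on D" using G(1) by (simp add: solution_on_def)
  have eps_holomorphic: "eps u \<psi> \<omega> W m holomorphic_on D" if "W holomorphic_on D" for W m
    unfolding eps_def[abs_def] using that \<open>u \<noteq> 0\<close>
    by (intro holomorphic_intros Gcoeff_holomorphic[OF \<gamma>.openD hol]) auto
  have eps_diff: "W z - W' z = eps u \<psi> \<omega> W m z - eps u \<psi> \<omega> W' m z" for W W' m z
    by (simp add: eps_def)
  show "\<exists>G. solution_on D u \<psi> \<omega> G \<and>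
         (\<forall>\<L> \<xi>. admissible_path \<Delta> u \<alpha> \<psi> \<omega> n \<L> \<and> range \<L> \<subseteq> D \<and> \<xi> \<in> range \<L> \<longrightarrow>
            norm (eps u \<psi> \<omega> G n \<xi>) \<le> error_bound u \<psi> \<omega> n \<L> \<xi> \<and>
            (\<forall>r\<ge>1. bound_terms_exist \<psi> \<omega> (n + r) \<L> \<longrightarrow>
               norm (eps u \<psi> \<omega> G n \<xi>) \<le>
                 norm (\<Sum>s = n..n + r - 1. Gcoeff \<psi> \<omega> s \<xi> / u ^ (2 * s + 2)) +
                 error_bound u \<psi> \<omega> (n + r) \<L> \<xi>)) \<and>
         (\<forall>H. solution_on D u \<psi> \<omega> H \<and>
              (\<forall>\<xi>\<in>range \<gamma>. norm (eps u \<psi> \<omega> H n \<xi>) \<le> error_bound u \<psi> \<omega> n \<gamma> \<xi>) \<longrightarrow>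
              (\<forall>\<xi>\<in>D. H \<xi> = G \<xi>))"
  proof (intro exI[of _ G] conjI allI impI ballI; (elim conjE)?)
    show "solution_on D u \<psi> \<omega> G" by (rule G)
  next
    fix H \<xi> assume H: "solution_on D u \<psi> \<omega> H"
      "\<forall>\<xi>\<in>range \<gamma>. norm (eps u \<psi> \<omega> H n \<xi>) \<le> error_bound u \<psi> \<omega> n \<gamma> \<xi>" and \<xi>: "\<xi> \<in> D"
    have "norm (H (\<gamma> \<tau>) - G (\<gamma> \<tau>)) \<le> C + C" for \<tau>
    proof -
      have "norm (H (\<gamma> \<tau>) - G (\<gamma> \<tau>)) \<le> norm (eps u \<psi> \<omega> H n (\<gamma> \<tau>)) + norm (eps u \<psi> \<omega> G n (\<gamma> \<tau>))"
        unfolding eps_diff[of H "\<gamma> \<tau>" G n] by (rule norm_triangle_ineq4)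
      also have "\<dots> \<le> C + C"
        using H(2) G(2)[of \<tau>] C[of \<tau>] by (intro add_mono) (auto intro: order_trans)
      finally show ?thesis .
    qed
    then show "H \<xi> = G \<xi>"
      by (rule \<gamma>.bounded_difference_of_solutions[OF hol(1) i\<psi>[OF \<gamma>] H(1) G(1) _ \<xi>])
  next
    fix \<L> \<xi> assume L: "admissible_path \<Delta> u \<alpha> \<psi> \<omega> n \<L>" and LD: "range \<L> \<subseteq> D" and \<xi>: "\<xi> \<in> range \<L>"
    interpret L: monotone_path D u \<L> using link[OF L] LD by (rule mp)
    obtain W where W: "solution_on D u \<psi> \<omega> W"
      "\<And>\<tau>. norm (eps u \<psi> \<omega> W n (\<L> \<tau>)) \<le> error_bound u \<psi> \<omega> n \<L> (\<L> \<tau>)"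
      using L.expansion_solution[OF hol(1) i\<psi>[OF L] hol(2) bt[OF L]] by blast
    obtain B where B: "\<And>\<tau>. error_bound u \<psi> \<omega> n \<L> (\<L> \<tau>) \<le> B"
      using error_bound_bounded[OF bt[OF L]] by blast
    have Wh: "W holomorphic_on D" using W(1) by (simp add: solution_on_def)
    \<comment> \<open>The remainder of \<open>W\<close> is controlled on \<open>\<L>\<close> only;
      the shared tails carry its boundedness over to \<gamma>, where \<open>W\<close> can be
      compared with \<open>G\<close>.\<close>
    obtain M where M: "\<And>\<tau>. norm (eps u \<psi> \<omega> W n (\<gamma> \<tau>)) \<le> M"
      using bounded_along_linking_paths[OF link[OF \<gamma>] link[OF L] \<gamma>.cont_path_hol[OF eps_holomorphic[OF Wh]],
        OF order_trans[OF W(2) B]] by blast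
    have WG: "W z = G z" if "z \<in> D" for z
    proof (rule \<gamma>.bounded_difference_of_solutions[OF hol(1) i\<psi>[OF \<gamma>] W(1) G(1) _ that])
      fix \<tau>
      have "norm (W (\<gamma> \<tau>) - G (\<gamma> \<tau>)) \<le> norm (eps u \<psi> \<omega> W n (\<gamma> \<tau>)) + norm (eps u \<psi> \<omega> G n (\<gamma> \<tau>))"
        unfolding eps_diff[of W "\<gamma> \<tau>" G n] by (rule norm_triangle_ineq4)
      also have "\<dots> \<le> M + C"
        using M G(2)[of \<tau>] C[of \<tau>] by (intro add_mono) (auto intro: order_trans)
      finally show "norm (W (\<gamma> \<tau>) - G (\<gamma> \<tau>)) \<le> M + C" .
    qed
    have bound: "norm (eps u \<psi> \<omega> G n (\<L> \<tau>)) \<le> error_bound u \<psi> \<omega> n \<L> (\<L> \<tau>)" for \<tau>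
      using W(2)[of \<tau>] WG[OF L.in_D] by (simp add: eps_def)
    with \<xi> show "norm (eps u \<psi> \<omega> G n \<xi>) \<le> error_bound u \<psi> \<omega> n \<L> \<xi>" by auto
    fix r :: nat assume r: "r \<ge> 1" and btr: "bound_terms_exist \<psi> \<omega> (n + r) \<L>"
    obtain V where V: "solution_on D u \<psi> \<omega> V"
      "\<And>\<tau>. norm (eps u \<psi> \<omega> V (n + r) (\<L> \<tau>)) \<le> error_bound u \<psi> \<omega> (n + r) \<L> (\<L> \<tau>)"
      using L.expansion_solution[OF hol(1) i\<psi>[OF L] hol(2) btr] by blast
    obtain B' where B': "\<And>\<tau>. error_bound u \<psi> \<omega> (n + r) \<L> (\<L> \<tau>) \<le> B'"
      using error_bound_bounded[OF btr] by blast
    obtain K where K: "\<And>\<tau> s. s < r \<Longrightarrow> norm (Gcoeff \<psi> \<omega> (n + s) (\<L> \<tau>)) \<le> K"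
      using L.intermediate_coefficients_bounded[OF hol(1) i\<psi>(1)[OF L] hol(2) bt[OF L] btr r] by blast
    \<comment> \<open>\<open>V\<close> and \<open>G\<close> come from different truncations; along
      the path their difference consists of two bounded remainders and the sum \<open>P\<close> of
      the terms in between. Once \<open>P\<close> is bounded, uniqueness identifies them, and
      \<open>G\<close> inherits the remainder estimate of \<open>V\<close>.\<close>
    define P where "P z = (\<Sum>s = n..<n + r. Gcoeff \<psi> \<omega> s z / u ^ (2 * s + 2))" for z
    have P: "norm (P (\<L> \<tau>)) \<le> (\<Sum>s = n..<n + r. K / norm u ^ (2 * s + 2))" for \<tau>
      unfolding P_def
    proof (rule order_trans[OF norm_sum], rule sum_mono)
      fix s assume "s \<in> {n..<n + r}"
      then have "norm (Gcoeff \<psi> \<omega> s (\<L> \<tau>)) \<le> K"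
        using K[of "s - n" \<tau>] by auto
      then show "norm (Gcoeff \<psi> \<omega> s (\<L> \<tau>) / u ^ (2 * s + 2)) \<le> K / norm u ^ (2 * s + 2)"
        unfolding norm_divide norm_power by (intro divide_right_mono) auto
    qed
    have GP: "eps u \<psi> \<omega> G n z = P z + eps u \<psi> \<omega> G (n + r) z" for z
      unfolding P_def by (rule eps_shift)
    have VG: "V z = G z" if "z \<in> D" for z
    proof (rule L.bounded_difference_of_solutions[OF hol(1) i\<psi>[OF L] V(1) G(1) _ that])
      fix \<tau>
      have "V (\<L> \<tau>) - G (\<L> \<tau>) = eps u \<psi> \<omega> V (n + r) (\<L> \<tau>) - eps u \<psi> \<omega> G n (\<L> \<tau>) + P (\<L> \<tau>)"
        unfolding GP by (simp add: eps_diff[of V "\<L> \<tau>" G "n + r"])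
      also have "norm \<dots> \<le> norm (eps u \<psi> \<omega> V (n + r) (\<L> \<tau>)) + norm (eps u \<psi> \<omega> G n (\<L> \<tau>)) + norm (P (\<L> \<tau>))"
        by (intro order_trans[OF norm_triangle_ineq] add_right_mono norm_triangle_ineq4)
      also have "\<dots> \<le> B' + B + (\<Sum>s = n..<n + r. K / norm u ^ (2 * s + 2))"
        by (intro add_mono P order_trans[OF V(2) B'] order_trans[OF bound B])
      finally show "norm (V (\<L> \<tau>) - G (\<L> \<tau>)) \<le> B' + B + (\<Sum>s = n..<n + r. K / norm u ^ (2 * s + 2))" .
    qed
    obtain \<tau> where \<tau>: "\<xi> = \<L> \<tau>" using \<xi> by blast
    have "norm (eps u \<psi> \<omega> G (n + r) \<xi>) \<le> error_bound u \<psi> \<omega> (n + r) \<L> \<xi>"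
      using V(2)[of \<tau>] VG[OF L.in_D[of \<tau>]] by (simp add: eps_def \<tau>)
    then have "norm (eps u \<psi> \<omega> G n \<xi>) \<le> norm (P \<xi>) + error_bound u \<psi> \<omega> (n + r) \<L> \<xi>"
      unfolding GP by (rule order_trans[OF norm_triangle_ineq add_left_mono])
    moreover have "{n..<n + r} = {n..n + r - 1}" using r by auto
    ultimately show "norm (eps u \<psi> \<omega> G n \<xi>) \<le>
        norm (\<Sum>s = n..n + r - 1. Gcoeff \<psi> \<omega> s \<xi> / u ^ (2 * s + 2)) +
        error_bound u \<psi> \<omega> (n + r) \<L> \<xi>"
      by (simp add: P_def)
  qed
qed

end
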